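(* Assume that either $\mu=\alpha_1\alpha_2<1/4$, or $\alpha_1=\alpha_2\in[1/2,1)$. The covariance kernel of $\{V_t\}_{t\ge0}$ is given as follows. (1) If $\mu<1/4$, then for $s,t>0$, with $r:=\min\{s,t\}$ and $q:=\max\{s,t\}$, $$\mathbb{E}[V_sV_t]=2r\,c_\mu\!\left(\log\frac qr\right)-\lambda\,C_\mu(s,t),\qquad C_\mu(s,t):=r\left(2c_\mu\!\left(\log\frac qr\right)+s_\mu\!\left(\log\frac qr\right)\right),$$ where $\lambda:=\dfrac{\nu(1-\nu)}{1-4\mu}$ and $\nu:=\alpha_1+\alpha_2$. (2) If $\alpha_1=\alpha_2\in(-1/2,1)$, then $$\mathbb{E}[V_sV_t]=\frac{2s}{1+2\alpha_1}\left(\frac ts\right)^{-\alpha_1},\qquad 0<s\le t.$$ In particular, $$\mathbb{E}[V_t^2]=\begin{cases}\dfrac{2t\{1-\alpha_1-\alpha_2+(\alpha_1-\alpha_2)^2\}}{1-4\alpha_1\alpha_2},&\mu<1/4,\\[3mm]\dfrac{2t}{1+2\alpha_1},&\alpha_1=\alpha_2\in[1/2,1).\end{cases}$$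
   Context: $\alpha_1,\alpha_2\in[-1,1]$, $\mu=\alpha_1\alpha_2$, $A=\begin{pmatrix}0&\alpha_1\\ \alpha_2&0\end{pmatrix}$, $x^A:=e^{(\log x)A}$ for $x>0$, $\mathbf e=(1,-1)^\top$. $V=\{V_t\}_{t\ge0}$ is the centered continuous real Gaussian process with $V_0=0$ given for $t>0$ by (a) $V_t=\int_0^t\mathbf e^\top(t/s)^A\,dB_s$ with $B$ a two-dimensional standard Brownian motion, if $\mu<1/4$; (b) $V_t=\sqrt2\int_0^t(t/s)^{-\alpha_1}\,dW_s$ with $W$ a standard Brownian motion, if $\alpha_1=\alpha_2\in[1/2,1)$. The functions $c_\mu,s_\mu$ are: $c_\mu(x)=\cosh(\sqrt\mu\,x)$, $1$, $\cos(\sqrt{-\mu}\,x)$ and $s_\mu(x)=\sinh(\sqrt\mu\,x)/\sqrt\mu$, $x$, $\sin(\sqrt{-\mu}\,x)/\sqrt{-\mu}$, according to whether $\mu>0$, $\mu=0$, $\mu<0$. *)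

theory Defs
  imports "HOL-Probability.Probability"
begin

section \<open>Brownian motion and Gaussian processes\<close>

text \<open>Standard Brownian motion with values in a Euclidean space (\<open>real\<close> or \<open>real ^ 'n\<close>), indexed
  by \<open>t \<ge> 0\<close>. The density of an increment is that of the centred normal law with covariance
  \<open>(t - s) I\<close>, so the coordinates are independent.\<close>

definition brownian_motion ::
    "'a measure \<Rightarrow> (real \<Rightarrow> 'a \<Rightarrow> 'b::euclidean_space) \<Rightarrow> bool" where
  "brownian_motion M B \<longleftrightarrow>
     prob_space M \<and>
     (\<forall>t\<ge>0. B t \<in> borel_measurable M) \<and>
     (AE \<omega> in M. B 0 \<omega> = 0) \<and>
     (AE \<omega> in M. continuous_on {0..} (\<lambda>t. B t \<omega>)) \<and>
     (\<forall>(n::nat) p. 0 \<le> p 0 \<longrightarrow> (\<forall>i<n. p i \<le> p (Suc i)) \<longrightarrow>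
        prob_space.indep_vars M (\<lambda>_. borel) (\<lambda>i \<omega>. B (p (Suc i)) \<omega> - B (p i) \<omega>) {..<n}) \<and>
     (\<forall>s t. 0 \<le> s \<longrightarrow> s < t \<longrightarrow>
        distributed M lborel (\<lambda>\<omega>. B t \<omega> - B s \<omega>)
          (\<lambda>x. ennreal (\<Prod>b\<in>Basis. normal_density 0 (sqrt (t - s)) (x \<bullet> b))))"

text \<open>The degenerate law at \<open>0\<close> counts as centred Gaussian.\<close>

definition centered_gaussian :: "'a measure \<Rightarrow> ('a \<Rightarrow> real) \<Rightarrow> bool" where
  "centered_gaussian M X \<longleftrightarrow>
     X \<in> borel_measurable M \<and>
     (distr M borel X = return borel 0 \<or>
      (\<exists>\<sigma>>0. distributed M lborel X (\<lambda>x. ennreal (normal_density 0 \<sigma> x))))"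

definition centered_gaussian_process :: "'a measure \<Rightarrow> (real \<Rightarrow> 'a \<Rightarrow> real) \<Rightarrow> bool" where
  "centered_gaussian_process M V \<longleftrightarrow>
     (\<forall>(n::nat) p a. (\<forall>i<n. 0 \<le> p i) \<longrightarrow>
        centered_gaussian M (\<lambda>\<omega>. \<Sum>i<n. a i * V (p i) \<omega>))"


section \<open>The Wiener integral of a deterministic function\<close>

definition step_fun :: "nat \<Rightarrow> (nat \<Rightarrow> real) \<Rightarrow> (nat \<Rightarrow> 'b) \<Rightarrow> real \<Rightarrow> 'b::euclidean_space" where
  "step_fun n p c s = (\<Sum>i<n. indicator {p i<..p (Suc i)} s *\<^sub>R c i)"

definition step_integral ::
    "(real \<Rightarrow> 'a \<Rightarrow> 'b) \<Rightarrow> nat \<Rightarrow> (nat \<Rightarrow> real) \<Rightarrow> (nat \<Rightarrow> 'b::euclidean_space) \<Rightarrow> 'a \<Rightarrow> real" where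
  "step_integral B n p c \<omega> = (\<Sum>i<n. c i \<bullet> (B (p (Suc i)) \<omega> - B (p i) \<omega>))"

text \<open>\<open>X\<close> is a version of the Wiener integral over \<open>(0, t]\<close> of \<open>f \<bullet> dB\<close>: the \<open>L\<^sup>2(M)\<close>-limit of the
  integrals of step functions that converge to \<open>f\<close> in \<open>L\<^sup>2(0, t)\<close>. By the isometry for step
  functions, such an \<open>X\<close> exists precisely for square-integrable \<open>f\<close>, does not depend on the
  approximating sequence and is unique up to null sets. The distances are nonnegative integrals, so
  that their convergence to \<open>0\<close> entails that they are eventually finite.\<close>

definition has_wiener_integral ::
    "'a measure \<Rightarrow> (real \<Rightarrow> 'a \<Rightarrow> 'b::euclidean_space) \<Rightarrow> real \<Rightarrow> (real \<Rightarrow> 'b) \<Rightarrow> ('a \<Rightarrow> real) \<Rightarrow> bool" where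
  "has_wiener_integral M B t f X \<longleftrightarrow>
     set_borel_measurable lborel {0<..t} f \<and>
     X \<in> borel_measurable M \<and>
     (\<exists>(n :: nat \<Rightarrow> nat) (p :: nat \<Rightarrow> nat \<Rightarrow> real) (c :: nat \<Rightarrow> nat \<Rightarrow> 'b).
        (\<forall>k. 0 \<le> p k 0 \<and> (\<forall>i<n k. p k i \<le> p k (Suc i)) \<and> p k (n k) \<le> t) \<and>
        (\<lambda>k. \<integral>\<^sup>+s\<in>{0<..t}. ennreal ((norm (step_fun (n k) (p k) (c k) s - f s))\<^sup>2) \<partial>lborel)
          \<longlonglongrightarrow> 0 \<and>
        (\<lambda>k. \<integral>\<^sup>+\<omega>. ennreal ((step_integral B (n k) (p k) (c k) \<omega> - X \<omega>)\<^sup>2) \<partial>M)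
          \<longlonglongrightarrow> 0)"


section \<open>Matrix powers\<close>

text \<open>Square matrices are not an instance of \<open>real_normed_algebra_1\<close>, so the library's \<open>exp\<close> does not
  apply to them.\<close>

definition mat_exp :: "real ^ 'n ^ 'n \<Rightarrow> real ^ 'n ^ 'n" where
  "mat_exp A = (\<Sum>k. (((**) A) ^^ k) (mat 1) /\<^sub>R fact k)"

definition mat_powr :: "real \<Rightarrow> real ^ 'n ^ 'n \<Rightarrow> real ^ 'n ^ 'n" where
  "mat_powr x A = mat_exp (ln x *\<^sub>R A)"

definition coupling_mat :: "real \<Rightarrow> real \<Rightarrow> real ^ 2 ^ 2" where
  "coupling_mat \<alpha>\<^sub>1 \<alpha>\<^sub>2 = vector [vector [0, \<alpha>\<^sub>1], vector [\<alpha>\<^sub>2, 0]]"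

definition evec :: "real ^ 2" where
  "evec = vector [1, -1]"


section \<open>The process and the functions in its covariance\<close>

text \<open>The two integral representations concern disjoint parameter ranges, since
  \<open>\<alpha>\<^sub>1 = \<alpha>\<^sub>2 \<ge> 1/2\<close> forces \<open>\<alpha>\<^sub>1 \<alpha>\<^sub>2 \<ge> 1/4\<close>. As \<open>V\<^sub>t\<close> is only determined up to null sets by its
  integral, all its defining properties are required almost surely.\<close>

definition process_V :: "real \<Rightarrow> real \<Rightarrow> 'a measure \<Rightarrow> (real \<Rightarrow> 'a \<Rightarrow> real) \<Rightarrow> bool" where
  "process_V \<alpha>\<^sub>1 \<alpha>\<^sub>2 M V \<longleftrightarrow>
     prob_space M \<and>
     centered_gaussian_process M V \<and>
     (AE \<omega> in M. continuous_on {0..} (\<lambda>t. V t \<omega>)) \<and>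
     (AE \<omega> in M. V 0 \<omega> = 0) \<and>
     (\<alpha>\<^sub>1 * \<alpha>\<^sub>2 < 1/4 \<longrightarrow>
        (\<exists>B :: real \<Rightarrow> 'a \<Rightarrow> real ^ 2. brownian_motion M B \<and>
           (\<forall>t>0. has_wiener_integral M B t
              (\<lambda>s. evec v* mat_powr (t / s) (coupling_mat \<alpha>\<^sub>1 \<alpha>\<^sub>2)) (V t)))) \<and>
     (\<alpha>\<^sub>1 = \<alpha>\<^sub>2 \<and> \<alpha>\<^sub>1 \<in> {1/2..<1} \<longrightarrow>
        (\<exists>W :: real \<Rightarrow> 'a \<Rightarrow> real. brownian_motion M W \<and>
           (\<forall>t>0. \<exists>I. has_wiener_integral M W t (\<lambda>s. (t / s) powr (- \<alpha>\<^sub>1)) I \<and>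
              (AE \<omega> in M. V t \<omega> = sqrt 2 * I \<omega>))))"

definition c_fun :: "real \<Rightarrow> real \<Rightarrow> real" where
  "c_fun \<mu> x = (if \<mu> > 0 then cosh (sqrt \<mu> * x) else if \<mu> = 0 then 1 else cos (sqrt (- \<mu>) * x))"

definition s_fun :: "real \<Rightarrow> real \<Rightarrow> real" where
  "s_fun \<mu> x =
     (if \<mu> > 0 then sinh (sqrt \<mu> * x) / sqrt \<mu>
      else if \<mu> = 0 then x
      else sin (sqrt (- \<mu>) * x) / sqrt (- \<mu>))"

definition C_kernel :: "real \<Rightarrow> real \<Rightarrow> real \<Rightarrow> real" where
  "C_kernel \<mu> s t =
     (let r = min s t; q = max s t in r * (2 * c_fun \<mu> (ln (q / r)) + s_fun \<mu> (ln (q / r))))"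

end

theory Submission imports Defs begin

text \<open>For \<open>s, t > 0\<close> the variables \<open>V s\<close> and \<open>V t\<close> are Wiener integrals with respect to one and
  the same Brownian motion, in the second representation up to the factor \<open>sqrt 2\<close>. By the Wiener
  isometry their covariance is therefore the integral over
  \<open>(0, r]\<close>, \<open>r = min s t\<close>, of the inner product of the two kernels
  (\<open>wiener_integral_isometry\<close>), and it remains to evaluate that integral.

  \<^bold>\<open>The isometry.\<close> Independence of the increments gives a Brownian motion the covariance
  \<open>min s t * (c \<bullet> d)\<close> in directions \<open>c\<close>, \<open>d\<close>. The mixed second difference of \<open>min\<close> over two
  intervals is the length of their intersection. Hence the integrals of two step functions have the
  covariance \<open>\<integral> f \<bullet> g\<close> even when the partitions differ (\<open>step_integral_isometry\<close>). The
  Cauchy-Schwarz inequality carries this identity to \<open>L\<^sup>2\<close>-limits on both sides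
  (\<open>L2_limit_integral_inner\<close>, used once on the probability space and once on the line).

  \<^bold>\<open>The case \<open>\<mu> < 1/4\<close>.\<close> The square of the coupling matrix \<open>A\<close> is \<open>\<mu>\<close> times the identity, so the
  exponential series splits into \<open>x\<^sup>A = c(ln x) + s(ln x) A\<close>, where \<open>c\<close>, \<open>s\<close> are \<open>c_fun \<mu>\<close>,
  \<open>s_fun \<mu>\<close>. Put \<open>x = ln (r / u)\<close> and \<open>y = ln (q / u)\<close> with \<open>q = max s t\<close>. By the addition theorems
  for \<open>c\<close> and \<open>s\<close>, the inner product of the kernels at \<open>u\<close> is
  \<open>2 c(y - x) + \<nu>\<^sup>2 s(x) s(y) - \<nu> s(x + y)\<close>. Here \<open>y - x = ln (q / r)\<close> does not depend on \<open>u\<close>, and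
  the derivatives in \<open>u\<close>
  \<open>(u s(x) s(y))' = s(x) s(y) - s(x + y)\<close> and
  \<open>(u (2 c(x + y) + s(x + y)))' = (1 - 4 \<mu>) s(x + y)\<close>
  provide the antiderivative
  \<open>2 u c(ln (q / r)) + \<nu>\<^sup>2 u s(x) s(y) - \<lambda> u (2 c(x + y) + s(x + y))\<close>.
  At \<open>u = r\<close> it has the claimed value, since \<open>x = 0\<close> and \<open>y = ln (q / r)\<close>. At
  \<open>u = 0\<close> it vanishes: \<open>c\<close> and \<open>s\<close> grow at most like
  \<open>exp (\<kappa> x)\<close> for some \<open>\<kappa> < 1/2\<close>, precisely because \<open>\<mu> < 1/4\<close>, and \<open>u (r q / u\<^sup>2)\<^sup>\<kappa>\<close> tends to \<open>0\<close>
  (\<open>integral_coupled_kernel\<close>).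

  \<^bold>\<open>Equal parameters.\<close> If both parameters are \<open>\<alpha> \<ge> 1/2\<close>, the product of the kernels is a multiple of
  \<open>u powr (2 * \<alpha>)\<close>, and its integral is immediate. If they are equal and smaller in absolute value
  than \<open>1/2\<close>, then \<open>\<lambda> = 2 \<alpha> / (1 + 2 \<alpha>)\<close>, and \<open>c(x) - \<alpha> s(x) = exp (- \<alpha> x)\<close> turns the general formula
  into the power law.\<close>

section \<open>Inner products of limits in \<open>L\<^sup>2\<close>\<close>

lemma integrable_inner_of_square_integrable:
  fixes X Y :: "'a \<Rightarrow> 'b::euclidean_space"
  assumes [measurable]: "X \<in> borel_measurable N" "Y \<in> borel_measurable N"
    and X: "integrable N (\<lambda>x. (norm (X x))\<^sup>2)" and Y: "integrable N (\<lambda>x. (norm (Y x))\<^sup>2)"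
  shows "integrable N (\<lambda>x. X x \<bullet> Y x)"
proof (rule Bochner_Integration.integrable_bound[OF Bochner_Integration.integrable_add[OF X Y]])
  show "AE x in N. norm (X x \<bullet> Y x) \<le> norm ((norm (X x))\<^sup>2 + (norm (Y x))\<^sup>2)"
  proof (rule AE_I2)
    fix x
    have "\<bar>X x \<bullet> Y x\<bar> \<le> norm (X x) * norm (Y x)" by (rule Cauchy_Schwarz_ineq2)
    also have "\<dots> \<le> (norm (X x))\<^sup>2 + (norm (Y x))\<^sup>2"
      using sum_squares_bound[of "norm (X x)" "norm (Y x)"]
        mult_nonneg_nonneg[OF norm_ge_zero[of "X x"] norm_ge_zero[of "Y x"]] by linarith
    finally show "norm (X x \<bullet> Y x) \<le> norm ((norm (X x))\<^sup>2 + (norm (Y x))\<^sup>2)" by simp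
  qed
qed simp

lemma integral_inner_Cauchy_Schwarz:
  fixes X Y :: "'a \<Rightarrow> 'b::euclidean_space"
  assumes [measurable]: "X \<in> borel_measurable N" "Y \<in> borel_measurable N"
    and X: "integrable N (\<lambda>x. (norm (X x))\<^sup>2)" and Y: "integrable N (\<lambda>x. (norm (Y x))\<^sup>2)"
  shows "\<bar>\<integral>x. X x \<bullet> Y x \<partial>N\<bar> \<le> sqrt ((\<integral>x. (norm (X x))\<^sup>2 \<partial>N) * (\<integral>x. (norm (Y x))\<^sup>2 \<partial>N))"
proof -
  have pt: "\<bar>X x \<bullet> Y x\<bar> \<le> norm (X x) * norm (Y x)" for x by (rule Cauchy_Schwarz_ineq2)
  have "(\<integral>\<^sup>+x. ennreal \<bar>X x \<bullet> Y x\<bar> \<partial>N) \<le> (\<integral>\<^sup>+x. ennreal (norm (X x)) * ennreal (norm (Y x)) \<partial>N)"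
    by (intro nn_integral_mono) (simp add: pt flip: ennreal_mult)
  then have "(\<integral>\<^sup>+x. ennreal \<bar>X x \<bullet> Y x\<bar> \<partial>N)\<^sup>2
      \<le> (\<integral>\<^sup>+x. ennreal (norm (X x)) * ennreal (norm (Y x)) \<partial>N)\<^sup>2"
    by (rule power_mono) simp
  also have "\<dots> \<le> (\<integral>\<^sup>+x. (ennreal (norm (X x)))\<^sup>2 \<partial>N) * (\<integral>\<^sup>+x. (ennreal (norm (Y x)))\<^sup>2 \<partial>N)"
    by (rule Cauchy_Schwarz_nn_integral) simp_all
  also have "\<dots> = ennreal ((\<integral>x. (norm (X x))\<^sup>2 \<partial>N) * (\<integral>x. (norm (Y x))\<^sup>2 \<partial>N))"
    using X Y by (simp add: ennreal_power nn_integral_eq_integral ennreal_mult)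
  finally have le: "(\<integral>\<^sup>+x. ennreal \<bar>X x \<bullet> Y x\<bar> \<partial>N)\<^sup>2
      \<le> ennreal ((\<integral>x. (norm (X x))\<^sup>2 \<partial>N) * (\<integral>x. (norm (Y x))\<^sup>2 \<partial>N))" .
  have "integrable N (\<lambda>x. X x \<bullet> Y x)"
    by (rule integrable_inner_of_square_integrable) (use X Y in simp_all)
  then have "(\<integral>\<^sup>+x. ennreal \<bar>X x \<bullet> Y x\<bar> \<partial>N) = ennreal (\<integral>x. \<bar>X x \<bullet> Y x\<bar> \<partial>N)"
    by (intro nn_integral_eq_integral) auto
  with le have "(\<integral>x. \<bar>X x \<bullet> Y x\<bar> \<partial>N)\<^sup>2 \<le> (\<integral>x. (norm (X x))\<^sup>2 \<partial>N) * (\<integral>x. (norm (Y x))\<^sup>2 \<partial>N)"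
    by (simp add: ennreal_power)
  then have "(\<integral>x. \<bar>X x \<bullet> Y x\<bar> \<partial>N) \<le> sqrt ((\<integral>x. (norm (X x))\<^sup>2 \<partial>N) * (\<integral>x. (norm (Y x))\<^sup>2 \<partial>N))"
    by (rule real_le_rsqrt)
  then show ?thesis using integral_abs_bound[of N "\<lambda>x. X x \<bullet> Y x"] by linarith
qed

lemma square_integrable_diff:
  fixes X Y :: "'a \<Rightarrow> 'b::euclidean_space"
  assumes [measurable]: "X \<in> borel_measurable N" "Y \<in> borel_measurable N"
    and X: "integrable N (\<lambda>x. (norm (X x))\<^sup>2)" and Y: "integrable N (\<lambda>x. (norm (Y x))\<^sup>2)"
  shows "integrable N (\<lambda>x. (norm (X x - Y x))\<^sup>2)"
proof (rule Bochner_Integration.integrable_bound)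
  show "integrable N (\<lambda>x. 2 * (norm (X x))\<^sup>2 + 2 * (norm (Y x))\<^sup>2)" using X Y by simp
  have "(norm (a - b))\<^sup>2 \<le> 2 * (norm a)\<^sup>2 + 2 * (norm b)\<^sup>2" for a b :: 'b
  proof -
    have "(norm (a - b))\<^sup>2 \<le> (norm a + norm b)\<^sup>2"
      by (intro power_mono norm_triangle_ineq4) simp
    then show ?thesis using sum_squares_bound[of "norm a" "norm b"]
      by (simp add: power2_sum)
  qed
  then show "AE x in N. norm ((norm (X x - Y x))\<^sup>2) \<le> norm (2 * (norm (X x))\<^sup>2 + 2 * (norm (Y x))\<^sup>2)"
    by simp
qed simp

text \<open>The distances are nonnegative integrals with values in \<open>[0, \<infinity>]\<close>. Once the limit is seen to be
  square-integrable, all of them are finite and the convergence may be read in the reals.\<close>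

lemma L2_limit_square_integrable:
  fixes X :: "'a \<Rightarrow> 'b::euclidean_space"
  assumes [measurable]: "\<And>k. Xs k \<in> borel_measurable N" "X \<in> borel_measurable N"
    and sq: "\<And>k. integrable N (\<lambda>x. (norm (Xs k x))\<^sup>2)"
    and lim: "(\<lambda>k::nat. \<integral>\<^sup>+x. ennreal ((norm (Xs k x - X x))\<^sup>2) \<partial>N) \<longlonglongrightarrow> 0"
  shows "integrable N (\<lambda>x. (norm (X x))\<^sup>2)"
    and "(\<lambda>k. \<integral>x. (norm (Xs k x - X x))\<^sup>2 \<partial>N) \<longlonglongrightarrow> 0"
proof -
  have "eventually (\<lambda>k. (\<integral>\<^sup>+x. ennreal ((norm (Xs k x - X x))\<^sup>2) \<partial>N) < 1) sequentially"
    by (rule order_tendstoD(2)[OF lim]) simp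
  then obtain k where "(\<integral>\<^sup>+x. ennreal ((norm (Xs k x - X x))\<^sup>2) \<partial>N) < 1"
    by (auto simp: eventually_sequentially)
  then have "integrable N (\<lambda>x. (norm (Xs k x - X x))\<^sup>2)"
    by (intro integrableI_nonneg) (auto simp: less_top[symmetric])
  from square_integrable_diff[OF _ _ sq[of k] this]
  show X: "integrable N (\<lambda>x. (norm (X x))\<^sup>2)" by simp
  have "integrable N (\<lambda>x. (norm (Xs k x - X x))\<^sup>2)" for k
    by (rule square_integrable_diff) (use sq X in simp_all)
  then have "(\<integral>\<^sup>+x. ennreal ((norm (Xs k x - X x))\<^sup>2) \<partial>N)
      = ennreal (\<integral>x. (norm (Xs k x - X x))\<^sup>2 \<partial>N)" for k
    by (simp add: nn_integral_eq_integral)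
  with lim have "(\<lambda>k. ennreal (\<integral>x. (norm (Xs k x - X x))\<^sup>2 \<partial>N)) \<longlonglongrightarrow> ennreal 0" by simp
  then show "(\<lambda>k. \<integral>x. (norm (Xs k x - X x))\<^sup>2 \<partial>N) \<longlonglongrightarrow> 0"
    by (subst (asm) tendsto_ennreal_iff) auto
qed

text \<open>The \<open>L\<^sup>2\<close> inner product is jointly continuous: the error splits as
  \<open>\<langle>X\<^sub>k - X, Y\<^sub>k - Y\<rangle> + \<langle>X\<^sub>k - X, Y\<rangle> + \<langle>X, Y\<^sub>k - Y\<rangle>\<close>, and each part is small by Cauchy-Schwarz. Vector
  values are allowed so that the lemma covers random variables as well as the integrands on the line.\<close>

lemma L2_limit_integral_inner:
  fixes X Y :: "'a \<Rightarrow> 'b::euclidean_space"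
  assumes [measurable]: "\<And>k. Xs k \<in> borel_measurable N" "X \<in> borel_measurable N"
      "\<And>k. Ys k \<in> borel_measurable N" "Y \<in> borel_measurable N"
    and sqX: "\<And>k. integrable N (\<lambda>x. (norm (Xs k x))\<^sup>2)"
    and sqY: "\<And>k. integrable N (\<lambda>x. (norm (Ys k x))\<^sup>2)"
    and limX: "(\<lambda>k::nat. \<integral>\<^sup>+x. ennreal ((norm (Xs k x - X x))\<^sup>2) \<partial>N) \<longlonglongrightarrow> 0"
    and limY: "(\<lambda>k::nat. \<integral>\<^sup>+x. ennreal ((norm (Ys k x - Y x))\<^sup>2) \<partial>N) \<longlonglongrightarrow> 0"
  shows "integrable N (\<lambda>x. X x \<bullet> Y x)"
    and "(\<lambda>k. \<integral>x. Xs k x \<bullet> Ys k x \<partial>N) \<longlonglongrightarrow> (\<integral>x. X x \<bullet> Y x \<partial>N)"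
proof -
  note X = L2_limit_square_integrable[OF assms(1,2) sqX limX]
  note Y = L2_limit_square_integrable[OF assms(3,4) sqY limY]
  have dX: "integrable N (\<lambda>x. (norm (Xs k x - X x))\<^sup>2)" for k
    by (rule square_integrable_diff) (use sqX X in simp_all)
  have dY: "integrable N (\<lambda>x. (norm (Ys k x - Y x))\<^sup>2)" for k
    by (rule square_integrable_diff) (use sqY Y in simp_all)
  show XY: "integrable N (\<lambda>x. X x \<bullet> Y x)"
    by (rule integrable_inner_of_square_integrable) (use X Y in simp_all)
  define a where "a k = (\<integral>x. (norm (Xs k x - X x))\<^sup>2 \<partial>N)" for k
  define b where "b k = (\<integral>x. (norm (Ys k x - Y x))\<^sup>2 \<partial>N)" for k
  define xx where "xx = (\<integral>x. (norm (X x))\<^sup>2 \<partial>N)"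
  define yy where "yy = (\<integral>x. (norm (Y x))\<^sup>2 \<partial>N)"
  have bound: "\<bar>(\<integral>x. Xs k x \<bullet> Ys k x \<partial>N) - (\<integral>x. X x \<bullet> Y x \<partial>N)\<bar>
      \<le> sqrt (a k * b k) + sqrt (a k * yy) + sqrt (xx * b k)" for k
  proof -
    have i1: "integrable N (\<lambda>x. (Xs k x - X x) \<bullet> (Ys k x - Y x))"
      by (rule integrable_inner_of_square_integrable) (use dX dY in simp_all)
    have i2: "integrable N (\<lambda>x. (Xs k x - X x) \<bullet> Y x)"
      by (rule integrable_inner_of_square_integrable) (use dX Y in simp_all)
    have i3: "integrable N (\<lambda>x. X x \<bullet> (Ys k x - Y x))"
      by (rule integrable_inner_of_square_integrable) (use X dY in simp_all)
    have "(\<integral>x. Xs k x \<bullet> Ys k x \<partial>N)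
        = (\<integral>x. (Xs k x - X x) \<bullet> (Ys k x - Y x) + (Xs k x - X x) \<bullet> Y x
             + X x \<bullet> (Ys k x - Y x) + X x \<bullet> Y x \<partial>N)"
      by (intro Bochner_Integration.integral_cong) (auto simp: algebra_simps)
    also have "\<dots> = (\<integral>x. (Xs k x - X x) \<bullet> (Ys k x - Y x) \<partial>N) + (\<integral>x. (Xs k x - X x) \<bullet> Y x \<partial>N)
             + (\<integral>x. X x \<bullet> (Ys k x - Y x) \<partial>N) + (\<integral>x. X x \<bullet> Y x \<partial>N)"
      using i1 i2 i3 XY by simp
    moreover have "\<bar>\<integral>x. (Xs k x - X x) \<bullet> (Ys k x - Y x) \<partial>N\<bar> \<le> sqrt (a k * b k)"
      unfolding a_def b_def by (rule integral_inner_Cauchy_Schwarz) (use dX dY in simp_all)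
    moreover have "\<bar>\<integral>x. (Xs k x - X x) \<bullet> Y x \<partial>N\<bar> \<le> sqrt (a k * yy)"
      unfolding a_def yy_def by (rule integral_inner_Cauchy_Schwarz) (use dX Y in simp_all)
    moreover have "\<bar>\<integral>x. X x \<bullet> (Ys k x - Y x) \<partial>N\<bar> \<le> sqrt (xx * b k)"
      unfolding b_def xx_def by (rule integral_inner_Cauchy_Schwarz) (use X dY in simp_all)
    ultimately show ?thesis by linarith
  qed
  have a: "a \<longlonglongrightarrow> 0" and b: "b \<longlonglongrightarrow> 0" using X(2) Y(2) unfolding a_def b_def .
  have "(\<lambda>k. sqrt (a k * b k) + sqrt (a k * yy) + sqrt (xx * b k))
      \<longlonglongrightarrow> sqrt (0 * 0) + sqrt (0 * yy) + sqrt (xx * 0)"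
    by (intro tendsto_intros a b)
  then have "(\<lambda>k. sqrt (a k * b k) + sqrt (a k * yy) + sqrt (xx * b k)) \<longlonglongrightarrow> 0" by simp
  then have "(\<lambda>k. (\<integral>x. Xs k x \<bullet> Ys k x \<partial>N) - (\<integral>x. X x \<bullet> Y x \<partial>N)) \<longlonglongrightarrow> 0"
    by (rule Lim_null_comparison[rotated]) (use bound in simp)
  then show "(\<lambda>k. \<integral>x. Xs k x \<bullet> Ys k x \<partial>N) \<longlonglongrightarrow> (\<integral>x. X x \<bullet> Y x \<partial>N)"
    by (simp add: LIM_zero_iff)
qed


section \<open>Covariance of Brownian motion\<close>

text \<open>In the coordinates of \<open>Basis\<close> Lebesgue measure is a product measure and the density a product, so
  every mixed moment of the coordinates factorises into one-dimensional normal moments. Bilinearity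
  then passes from the basis to arbitrary directions \<open>c\<close>, \<open>d\<close>.\<close>

lemma (in prob_space) second_moments_isotropic_normal:
  fixes D :: "'a \<Rightarrow> 'b::euclidean_space"
  assumes D: "distributed M lborel D
      (\<lambda>x. ennreal (\<Prod>b\<in>Basis. normal_density 0 \<sigma> (x \<bullet> b)))" and s: "0 < \<sigma>"
  shows "integrable M (\<lambda>\<omega>. c \<bullet> D \<omega>)" and "expectation (\<lambda>\<omega>. c \<bullet> D \<omega>) = 0"
    and "integrable M (\<lambda>\<omega>. (c \<bullet> D \<omega>) * (d \<bullet> D \<omega>))"
    and "expectation (\<lambda>\<omega>. (c \<bullet> D \<omega>) * (d \<bullet> D \<omega>)) = \<sigma>\<^sup>2 * (c \<bullet> d)"
proof -
  let ?n = "normal_density 0 \<sigma>"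
  \<comment> \<open>A general multi-index \<open>m\<close> covers the moments of order one and two needed below.\<close>
  have mom: "integrable M (\<lambda>\<omega>. \<Prod>b\<in>Basis. (D \<omega> \<bullet> b) ^ m b) \<and>
      expectation (\<lambda>\<omega>. \<Prod>b\<in>Basis. (D \<omega> \<bullet> b) ^ m b)
        = (\<Prod>b\<in>Basis. \<integral>x. ?n x * x ^ m b \<partial>lborel)" for m :: "'b \<Rightarrow> nat"
  proof -
    interpret product_sigma_finite "\<lambda>b::'b. lborel :: real measure" by standard
    have f: "integrable lborel (\<lambda>x. ?n x * x ^ m b)" for b
      using integrable_normal_moment[OF s, of 0 "m b"] by simp
    have repr: "(\<Sum>b\<in>Basis. x b *\<^sub>R b) \<bullet> i = x i" if "i \<in> Basis" for x :: "'b \<Rightarrow> real" and i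
      using that by (simp add: inner_sum_left inner_Basis if_distrib cong: if_cong)
    have pr: "(\<Prod>b\<in>Basis. ?n (x b)) * (\<Prod>b\<in>Basis. x b ^ m b)
        = (\<Prod>b\<in>Basis. ?n (x b) * x b ^ m b)" for x :: "'b \<Rightarrow> real"
      by (rule prod.distrib[symmetric])
    have int: "integrable lborel (\<lambda>x::'b. (\<Prod>b\<in>Basis. ?n (x \<bullet> b)) * (\<Prod>b\<in>Basis. (x \<bullet> b) ^ m b))"
      by (subst lborel_eq, subst integrable_distr_eq)
        (auto simp: repr pr intro!: product_integrable_prod f)
    have "(\<integral>x. (\<Prod>b\<in>Basis. ?n (x \<bullet> b)) * (\<Prod>b\<in>Basis. (x \<bullet> b) ^ m b) \<partial>(lborel :: 'b measure))
        = (\<Prod>b\<in>Basis. \<integral>x. ?n x * x ^ m b \<partial>lborel)"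
      by (subst lborel_eq, subst integral_distr)
        (auto simp: repr pr intro!: product_integral_prod f)
    with int show ?thesis
      using distributed_integrable[OF D, of "\<lambda>x. \<Prod>b\<in>Basis. (x \<bullet> b) ^ m b"]
        distributed_integral[OF D, of "\<lambda>x. \<Prod>b\<in>Basis. (x \<bullet> b) ^ m b"]
      by (simp add: prod_nonneg)
  qed
  have m0: "(\<integral>x. ?n x \<partial>lborel) = 1" by (rule integral_normal_density[OF s])
  have m1: "(\<integral>x. ?n x * x \<partial>lborel) = 0" using integral_normal_moment_nz_1[OF s, of 0] by simp
  have m2: "(\<integral>x. ?n x * x\<^sup>2 \<partial>lborel) = \<sigma>\<^sup>2"
    using integral_normal_moment_even[OF s, of 0 1] by (simp add: fact_numeral)
  have one: "integrable M (\<lambda>\<omega>. D \<omega> \<bullet> i) \<and> expectation (\<lambda>\<omega>. D \<omega> \<bullet> i) = 0" if i: "i \<in> Basis" for i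
  proof -
    have "(\<Prod>b\<in>Basis. y b ^ (if b = i then 1 else 0)) = y i" for y :: "'b \<Rightarrow> real"
      using i by (simp add: if_distrib[of "\<lambda>n. _ ^ n"] cong: if_cong)
    moreover have "(\<Prod>b\<in>Basis. \<integral>x. ?n x * x ^ (if b = i then 1 else 0) \<partial>lborel) = 0"
      using i m1 by (intro prod_zero) (auto intro!: bexI[of _ i])
    ultimately show ?thesis using mom[of "\<lambda>b. if b = i then 1 else 0"] by simp
  qed
  have two: "integrable M (\<lambda>\<omega>. (D \<omega> \<bullet> i) * (D \<omega> \<bullet> j)) \<and>
      expectation (\<lambda>\<omega>. (D \<omega> \<bullet> i) * (D \<omega> \<bullet> j)) = (if i = j then \<sigma>\<^sup>2 else 0)"
    if i: "i \<in> Basis" and j: "j \<in> Basis" for i j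
  proof (cases "i = j")
    case True
    have "(\<Prod>b\<in>Basis. y b ^ (if b = i then 2 else 0)) = y i * y i" for y :: "'b \<Rightarrow> real"
      using i by (simp add: if_distrib[of "\<lambda>n. _ ^ n"] power2_eq_square cong: if_cong)
    moreover have "(\<integral>x. ?n x * x ^ (if b = i then 2 else 0) \<partial>lborel) = (if b = i then \<sigma>\<^sup>2 else 1)" for b
      using m0 m2 by simp
    ultimately show ?thesis using mom[of "\<lambda>b. if b = i then 2 else 0"] True i by simp
  next
    case False
    have "(\<Prod>b\<in>Basis. y b ^ (if b = i \<or> b = j then 1 else 0)) = y i * y j" for y :: "'b \<Rightarrow> real"
    proof -
      have "(\<Prod>b\<in>Basis. y b ^ (if b = i \<or> b = j then 1 else 0)) = (\<Prod>b\<in>{i,j}. y b)"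
        using i j by (intro prod.mono_neutral_cong_right) auto
      then show ?thesis using False by simp
    qed
    moreover have "(\<Prod>b\<in>Basis. \<integral>x. ?n x * x ^ (if b = i \<or> b = j then 1 else 0) \<partial>lborel) = 0"
      using i m1 by (intro prod_zero) (auto intro!: bexI[of _ i])
    ultimately show ?thesis using mom[of "\<lambda>b. if b = i \<or> b = j then 1 else 0"] False by simp
  qed
  have c1: "(\<lambda>\<omega>. c \<bullet> D \<omega>) = (\<lambda>\<omega>. \<Sum>i\<in>Basis. (c \<bullet> i) * (D \<omega> \<bullet> i))"
    by (rule ext, rule euclidean_inner)
  show "integrable M (\<lambda>\<omega>. c \<bullet> D \<omega>)" "expectation (\<lambda>\<omega>. c \<bullet> D \<omega>) = 0"
    unfolding c1 using one by simp_all
  have cd: "(\<lambda>\<omega>. (c \<bullet> D \<omega>) * (d \<bullet> D \<omega>))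
      = (\<lambda>\<omega>. \<Sum>i\<in>Basis. \<Sum>j\<in>Basis. (c \<bullet> i) * (d \<bullet> j) * ((D \<omega> \<bullet> i) * (D \<omega> \<bullet> j)))"
    unfolding euclidean_inner[of c "D _"] euclidean_inner[of d "D _"] sum_product
    by (simp add: mult_ac)
  show "integrable M (\<lambda>\<omega>. (c \<bullet> D \<omega>) * (d \<bullet> D \<omega>))"
    unfolding cd using two by simp
  have "expectation (\<lambda>\<omega>. (c \<bullet> D \<omega>) * (d \<bullet> D \<omega>))
      = (\<Sum>i\<in>Basis. \<Sum>j\<in>Basis. (c \<bullet> i) * (d \<bullet> j) * (if i = j then \<sigma>\<^sup>2 else 0))"
    unfolding cd using two by simp
  also have "\<dots> = \<sigma>\<^sup>2 * (\<Sum>i\<in>Basis. (c \<bullet> i) * (d \<bullet> i))"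
    by (simp add: sum_distrib_left mult_ac if_distrib cong: if_cong)
  also have "\<dots> = \<sigma>\<^sup>2 * (c \<bullet> d)" by (simp only: euclidean_inner[of c d])
  finally show "expectation (\<lambda>\<omega>. (c \<bullet> D \<omega>) * (d \<bullet> D \<omega>)) = \<sigma>\<^sup>2 * (c \<bullet> d)" .
qed

text \<open>For \<open>s \<le> t\<close> the increment over \<open>(s, t]\<close> is centred and independent of the one over \<open>(0, s]\<close>, so
  only the variance at the earlier time survives.\<close>

lemma brownian_covariance:
  fixes B :: "real \<Rightarrow> 'a \<Rightarrow> 'b::euclidean_space"
  assumes B: "brownian_motion M B" and st: "0 \<le> s" "0 \<le> t"
  shows "integrable M (\<lambda>\<omega>. (c \<bullet> (B s \<omega> - B 0 \<omega>)) * (d \<bullet> (B t \<omega> - B 0 \<omega>)))"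
    and "(\<integral>\<omega>. (c \<bullet> (B s \<omega> - B 0 \<omega>)) * (d \<bullet> (B t \<omega> - B 0 \<omega>)) \<partial>M) = min s t * (c \<bullet> d)"
proof -
  interpret prob_space M using B by (simp add: brownian_motion_def)
  have incr: "integrable M (\<lambda>\<omega>. c \<bullet> (B v \<omega> - B u \<omega>)) \<and>
      expectation (\<lambda>\<omega>. c \<bullet> (B v \<omega> - B u \<omega>)) = 0 \<and>
      integrable M (\<lambda>\<omega>. (c \<bullet> (B v \<omega> - B u \<omega>)) * (d \<bullet> (B v \<omega> - B u \<omega>))) \<and>
      expectation (\<lambda>\<omega>. (c \<bullet> (B v \<omega> - B u \<omega>)) * (d \<bullet> (B v \<omega> - B u \<omega>))) = (v - u) * (c \<bullet> d)"
    if "0 \<le> u" "u \<le> v" for u v c d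
  proof (cases "u = v")
    case False
    then have "distributed M lborel (\<lambda>\<omega>. B v \<omega> - B u \<omega>)
          (\<lambda>x. ennreal (\<Prod>b\<in>Basis. normal_density 0 (sqrt (v - u)) (x \<bullet> b)))"
      using B that by (simp add: brownian_motion_def)
    from second_moments_isotropic_normal[OF this] that False show ?thesis by simp
  qed simp
  have ord: "integrable M (\<lambda>\<omega>. (c \<bullet> (B s \<omega> - B 0 \<omega>)) * (d \<bullet> (B t \<omega> - B 0 \<omega>))) \<and>
      expectation (\<lambda>\<omega>. (c \<bullet> (B s \<omega> - B 0 \<omega>)) * (d \<bullet> (B t \<omega> - B 0 \<omega>))) = s * (c \<bullet> d)"
    if "0 \<le> s" "s \<le> t" for s t c d
  proof -
    \<comment> \<open>Only \<open>p 0, p 1, p 2\<close> matter: two adjacent increments, over \<open>(0, s]\<close> and \<open>(s, t]\<close>.\<close>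
    define p where "p i = (if i = 0 then 0 else if i = 1 then s else t)" for i :: nat
    define D where "D i \<omega> = (if i = (0::nat) then c else d) \<bullet> (B (p (Suc i)) \<omega> - B (p i) \<omega>)" for i \<omega>
    have "indep_vars (\<lambda>_. borel) (\<lambda>i \<omega>. B (p (Suc i)) \<omega> - B (p i) \<omega>) {..<2}"
    proof -
      have "0 \<le> p 0" "\<forall>i<2. p i \<le> p (Suc i)" using that by (auto simp: p_def less_2_cases_iff)
      moreover have "\<forall>(n::nat) p. 0 \<le> p 0 \<longrightarrow> (\<forall>i<n. p i \<le> p (Suc i)) \<longrightarrow>
          indep_vars (\<lambda>_. borel) (\<lambda>i \<omega>. B (p (Suc i)) \<omega> - B (p i) \<omega>) {..<n}"
        using B unfolding brownian_motion_def by (elim conjE)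
      ultimately show ?thesis by simp
    qed
    then have ind: "indep_vars (\<lambda>_. borel) D {..<2}"
      unfolding D_def by (rule indep_vars_compose2) simp
    have D01: "D 0 = (\<lambda>\<omega>. c \<bullet> (B s \<omega> - B 0 \<omega>))" "D (Suc 0) = (\<lambda>\<omega>. d \<bullet> (B t \<omega> - B s \<omega>))"
      by (simp_all add: D_def p_def fun_eq_iff)
    have intD: "integrable M (D i) \<and> expectation (D i) = 0" if "i < 2" for i
      using that incr[of 0 s c c] incr[of s t d d] \<open>0 \<le> s\<close> \<open>s \<le> t\<close>
      by (auto simp: D01 less_2_cases_iff)
    have "integrable M (\<lambda>\<omega>. \<Prod>i<2. D i \<omega>)"
      by (rule indep_vars_integrable[OF _ ind]) (use intD in simp_all)
    moreover have "expectation (\<lambda>\<omega>. \<Prod>i<2. D i \<omega>) = (\<Prod>i<2. expectation (D i))"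
      by (rule indep_vars_lebesgue_integral[OF _ ind]) (use intD in simp_all)
    ultimately have cross: "integrable M (\<lambda>\<omega>. (c \<bullet> (B s \<omega> - B 0 \<omega>)) * (d \<bullet> (B t \<omega> - B s \<omega>)))"
      "expectation (\<lambda>\<omega>. (c \<bullet> (B s \<omega> - B 0 \<omega>)) * (d \<bullet> (B t \<omega> - B s \<omega>))) = 0"
      using intD[of 0] by (simp_all add: D_def p_def numeral_2_eq_2)
    have split: "(c \<bullet> (B s \<omega> - B 0 \<omega>)) * (d \<bullet> (B t \<omega> - B 0 \<omega>))
        = (c \<bullet> (B s \<omega> - B 0 \<omega>)) * (d \<bullet> (B s \<omega> - B 0 \<omega>))
          + (c \<bullet> (B s \<omega> - B 0 \<omega>)) * (d \<bullet> (B t \<omega> - B s \<omega>))" for \<omega>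
      by (simp add: inner_diff_right algebra_simps)
    show ?thesis unfolding split using cross incr[of 0 s c d] that by simp
  qed
  show "integrable M (\<lambda>\<omega>. (c \<bullet> (B s \<omega> - B 0 \<omega>)) * (d \<bullet> (B t \<omega> - B 0 \<omega>)))"
    "(\<integral>\<omega>. (c \<bullet> (B s \<omega> - B 0 \<omega>)) * (d \<bullet> (B t \<omega> - B 0 \<omega>)) \<partial>M) = min s t * (c \<bullet> d)"
    using ord[of s t c d] ord[of t s d c] st
    by (cases "s \<le> t"; simp add: mult.commute inner_commute)+
qed


section \<open>The Wiener isometry\<close>

lemma partition_mono:
  fixes p :: "nat \<Rightarrow> real"
  assumes "\<forall>i<n. p i \<le> p (Suc i)" "i \<le> j" "j \<le> n"
  shows "p i \<le> p j"
  using assms(2,3)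
proof (induction j rule: dec_induct)
  case (step j)
  then show ?case using assms(1) by (meson Suc_le_lessD less_imp_le order_trans)
qed simp

text \<open>The mixed second difference of \<open>min\<close> is what the covariance of two Brownian increments amounts to.\<close>

lemma measure_Ioc_Int_Ioc:
  fixes u v u' v' :: real
  assumes "u \<le> v" "u' \<le> v'"
  shows "measure lborel ({u<..v} \<inter> {u'<..v'}) = min v v' - min v u' - min u v' + min u u'"
proof -
  have "{u<..v} \<inter> {u'<..v'} = {max u u'<..min v v'}" by auto
  moreover have "measure lborel {a<..b} = (if a \<le> b then b - a else 0)" for a b :: real by simp
  ultimately show ?thesis using assms by (auto simp: min_def max_def)
qed

lemma integral_sum_sum:
  fixes Q :: "nat \<Rightarrow> nat \<Rightarrow> 'a \<Rightarrow> real"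
  assumes "\<And>i j. i < n \<Longrightarrow> j < m \<Longrightarrow> integrable M (Q i j)"
  shows "integrable M (\<lambda>x. \<Sum>i<n. \<Sum>j<m. Q i j x)"
    and "(\<integral>x. (\<Sum>i<n. \<Sum>j<m. Q i j x) \<partial>M) = (\<Sum>i<n. \<Sum>j<m. \<integral>x. Q i j x \<partial>M)"
proof -
  have row: "integrable M (\<lambda>x. \<Sum>j<m. Q i j x)" if "i < n" for i
    by (rule Bochner_Integration.integrable_sum) (use assms that in simp)
  show "integrable M (\<lambda>x. \<Sum>i<n. \<Sum>j<m. Q i j x)"
    by (rule Bochner_Integration.integrable_sum) (use row in simp)
  have "(\<integral>x. (\<Sum>i<n. \<Sum>j<m. Q i j x) \<partial>M) = (\<Sum>i<n. \<integral>x. (\<Sum>j<m. Q i j x) \<partial>M)"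
    by (rule Bochner_Integration.integral_sum) (use row in simp)
  also have "\<dots> = (\<Sum>i<n. \<Sum>j<m. \<integral>x. Q i j x \<partial>M)"
    by (intro sum.cong refl Bochner_Integration.integral_sum) (use assms in simp)
  finally show "(\<integral>x. (\<Sum>i<n. \<Sum>j<m. Q i j x) \<partial>M) = (\<Sum>i<n. \<Sum>j<m. \<integral>x. Q i j x \<partial>M)" .
qed

text \<open>Both sides are bilinear in the coefficients, so the identity is checked cell by cell, where it is
  \<open>measure_Ioc_Int_Ioc\<close>. This compares unrelated partitions, as the
  approximation of two different kernels requires.\<close>

lemma step_integral_isometry:
  fixes B :: "real \<Rightarrow> 'a \<Rightarrow> 'b::euclidean_space"
  assumes B: "brownian_motion M B"
    and p: "0 \<le> p 0" "\<forall>i<n. p i \<le> p (Suc i)" and q: "0 \<le> q 0" "\<forall>j<m. q j \<le> q (Suc j)"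
  shows "integrable M (\<lambda>\<omega>. step_integral B n p c \<omega> * step_integral B m q d \<omega>)"
    and "integrable lborel (\<lambda>x. step_fun n p c x \<bullet> step_fun m q d x)"
    and "(\<integral>\<omega>. step_integral B n p c \<omega> * step_integral B m q d \<omega> \<partial>M)
      = (\<integral>x. step_fun n p c x \<bullet> step_fun m q d x \<partial>lborel)"
proof -
  have p0: "0 \<le> p i" if "i \<le> n" for i using partition_mono[OF p(2), of 0 i] that p(1) by simp
  have q0: "0 \<le> q i" if "i \<le> m" for i using partition_mono[OF q(2), of 0 i] that q(1) by simp
  let ?L = "\<lambda>i j. measure lborel ({p i<..p (Suc i)} \<inter> {q j<..q (Suc j)})"
  have cell: "integrable M (\<lambda>\<omega>. (c i \<bullet> (B (p (Suc i)) \<omega> - B (p i) \<omega>)) * (d j \<bullet> (B (q (Suc j)) \<omega> - B (q j) \<omega>)))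
      \<and> (\<integral>\<omega>. (c i \<bullet> (B (p (Suc i)) \<omega> - B (p i) \<omega>)) * (d j \<bullet> (B (q (Suc j)) \<omega> - B (q j) \<omega>)) \<partial>M)
        = ?L i j * (c i \<bullet> d j)" if "i < n" "j < m" for i j
  proof -
    let ?W = "\<lambda>e t \<omega>. e \<bullet> (B t \<omega> - B 0 \<omega>)"
    have nn: "0 \<le> p i" "0 \<le> p (Suc i)" "0 \<le> q j" "0 \<le> q (Suc j)" using that p0 q0 by simp_all
    have split: "(c i \<bullet> (B (p (Suc i)) \<omega> - B (p i) \<omega>)) * (d j \<bullet> (B (q (Suc j)) \<omega> - B (q j) \<omega>))
        = ?W (c i) (p (Suc i)) \<omega> * ?W (d j) (q (Suc j)) \<omega> - ?W (c i) (p (Suc i)) \<omega> * ?W (d j) (q j) \<omega>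
          - ?W (c i) (p i) \<omega> * ?W (d j) (q (Suc j)) \<omega> + ?W (c i) (p i) \<omega> * ?W (d j) (q j) \<omega>" for \<omega>
      by (simp add: inner_diff_right algebra_simps)
    have "?L i j = min (p (Suc i)) (q (Suc j)) - min (p (Suc i)) (q j) - min (p i) (q (Suc j)) + min (p i) (q j)"
      using that p q by (intro measure_Ioc_Int_Ioc) auto
    then show ?thesis
      unfolding split using brownian_covariance[OF B] nn by (simp add: left_diff_distrib distrib_right)
  qed
  have prodM: "step_integral B n p c \<omega> * step_integral B m q d \<omega>
      = (\<Sum>i<n. \<Sum>j<m. (c i \<bullet> (B (p (Suc i)) \<omega> - B (p i) \<omega>)) * (d j \<bullet> (B (q (Suc j)) \<omega> - B (q j) \<omega>)))" for \<omega>
    by (simp add: step_integral_def sum_product)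
  have ind: "integrable lborel (\<lambda>x. indicator ({p i<..p (Suc i)} \<inter> {q j<..q (Suc j)}) x * (c i \<bullet> d j) :: real)" for i j
  proof -
    have "emeasure lborel ({p i<..p (Suc i)} \<inter> {q j<..q (Suc j)}) \<le> emeasure lborel {p i..p (Suc i)}"
      by (intro emeasure_mono) auto
    also have "\<dots> < \<infinity>" by (simp add: emeasure_lborel_Icc_eq)
    finally show ?thesis by (intro integrable_mult_left) (simp add: integrable_indicator_iff)
  qed
  have prodL: "step_fun n p c x \<bullet> step_fun m q d x
      = (\<Sum>i<n. \<Sum>j<m. indicator ({p i<..p (Suc i)} \<inter> {q j<..q (Suc j)}) x * (c i \<bullet> d j))" for x
    unfolding step_fun_def inner_sum_left unfolding inner_sum_right
    by (simp only: inner_scaleR_left inner_scaleR_right indicator_inter_arith mult_ac)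
  show "integrable M (\<lambda>\<omega>. step_integral B n p c \<omega> * step_integral B m q d \<omega>)"
    unfolding prodM using cell by (intro integral_sum_sum(1)) blast
  show "integrable lborel (\<lambda>x. step_fun n p c x \<bullet> step_fun m q d x)"
    unfolding prodL by (intro integral_sum_sum(1) ind)
  have "(\<integral>\<omega>. step_integral B n p c \<omega> * step_integral B m q d \<omega> \<partial>M)
      = (\<Sum>i<n. \<Sum>j<m. ?L i j * (c i \<bullet> d j))"
    unfolding prodM using cell by (subst integral_sum_sum(2)) (blast, intro sum.cong, auto)
  also have "?L i j * (c i \<bullet> d j)
      = (\<integral>x. indicator ({p i<..p (Suc i)} \<inter> {q j<..q (Suc j)}) x * (c i \<bullet> d j) \<partial>lborel)" for i j
    by (simp del: Int_greaterThanAtMost)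
  then have "(\<Sum>i<n. \<Sum>j<m. ?L i j * (c i \<bullet> d j)) = (\<integral>x. step_fun n p c x \<bullet> step_fun m q d x \<partial>lborel)"
    unfolding prodL by (subst integral_sum_sum(2)[OF ind]) (simp only:)
  finally show "(\<integral>\<omega>. step_integral B n p c \<omega> * step_integral B m q d \<omega> \<partial>M)
      = (\<integral>x. step_fun n p c x \<bullet> step_fun m q d x \<partial>lborel)" .
qed

lemma step_fun_eq_0:
  assumes "0 \<le> p 0" "\<forall>i<n. p i \<le> p (Suc i)" "p n \<le> t" "x \<notin> {0<..t}"
  shows "step_fun n p c x = 0"
  unfolding step_fun_def
proof (rule sum.neutral, rule ballI)
  fix i assume "i \<in> {..<n}"
  then have "p 0 \<le> p i" "p (Suc i) \<le> p n" using partition_mono[OF assms(2)] by auto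
  then show "indicator {p i<..p (Suc i)} x *\<^sub>R c i = 0" using assms by auto
qed

lemma step_fun_measurable [measurable]: "step_fun n p c \<in> borel_measurable borel"
  unfolding step_fun_def[abs_def] by measurable

lemma step_integral_measurable:
  assumes B: "brownian_motion M B" and p: "0 \<le> p 0" "\<forall>i<n. p i \<le> p (Suc i)"
  shows "step_integral B n p c \<in> borel_measurable M"
proof -
  have "0 \<le> p i" if "i \<le> n" for i using partition_mono[OF p(2), of 0 i] that p(1) by simp
  then have "B (p i) \<in> borel_measurable M" if "i \<le> n" for i
    using B that by (simp add: brownian_motion_def)
  then show ?thesis unfolding step_integral_def[abs_def]
    by (intro borel_measurable_sum borel_measurable_inner borel_measurable_diff borel_measurable_const) auto
qed

text \<open>The approximating step functions of the integral over the shorter interval vanish outside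
  \<open>(0, s]\<close>. Therefore those of the other integral matter on \<open>(0, s]\<close> only, and there they still
  converge in \<open>L\<^sup>2\<close>.\<close>

lemma wiener_integral_isometry:
  fixes B :: "real \<Rightarrow> 'a \<Rightarrow> 'b::euclidean_space"
  assumes B: "brownian_motion M B" and X: "has_wiener_integral M B s f X"
    and Y: "has_wiener_integral M B t g Y" and st: "s \<le> t"
  shows "integrable M (\<lambda>\<omega>. X \<omega> * Y \<omega>)"
    and "set_integrable lborel {0<..s} (\<lambda>u. f u \<bullet> g u)"
    and "(\<integral>\<omega>. X \<omega> * Y \<omega> \<partial>M) = (LBINT u:{0<..s}. f u \<bullet> g u)"
proof -
  let ?A = "{0<..s}"
  obtain n p c where p: "\<And>k. 0 \<le> p k 0" "\<And>k. \<forall>i<n k. p k i \<le> p k (Suc i)" "\<And>k. p k (n k) \<le> s"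
    and limf: "(\<lambda>k::nat. \<integral>\<^sup>+x\<in>?A. ennreal ((norm (step_fun (n k) (p k) (c k) x - f x))\<^sup>2) \<partial>lborel) \<longlonglongrightarrow> 0"
    and limX: "(\<lambda>k. \<integral>\<^sup>+\<omega>. ennreal ((step_integral B (n k) (p k) (c k) \<omega> - X \<omega>)\<^sup>2) \<partial>M) \<longlonglongrightarrow> 0"
    using X unfolding has_wiener_integral_def by blast
  obtain m q d where q: "\<And>k. 0 \<le> q k 0" "\<And>k. \<forall>i<m k. q k i \<le> q k (Suc i)"
    and limg: "(\<lambda>k::nat. \<integral>\<^sup>+x\<in>{0<..t}. ennreal ((norm (step_fun (m k) (q k) (d k) x - g x))\<^sup>2) \<partial>lborel) \<longlonglongrightarrow> 0"
    and limY: "(\<lambda>k. \<integral>\<^sup>+\<omega>. ennreal ((step_integral B (m k) (q k) (d k) \<omega> - Y \<omega>)\<^sup>2) \<partial>M) \<longlonglongrightarrow> 0"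
    using Y unfolding has_wiener_integral_def by blast
  have [measurable]: "X \<in> borel_measurable M" "Y \<in> borel_measurable M"
    using X Y by (simp_all add: has_wiener_integral_def)
  have [measurable]: "step_integral B (n k) (p k) (c k) \<in> borel_measurable M"
    "step_integral B (m k) (q k) (d k) \<in> borel_measurable M" for k
    using step_integral_measurable[OF B] p q by simp_all
  have mf [measurable]: "(\<lambda>x. indicator ?A x *\<^sub>R f x) \<in> borel_measurable lborel"
    using X by (simp add: has_wiener_integral_def set_borel_measurable_def)
  have "(\<lambda>x. indicator {0<..t} x *\<^sub>R g x) \<in> borel_measurable lborel"
    using Y by (simp add: has_wiener_integral_def set_borel_measurable_def)
  then have "(\<lambda>x. indicator ?A x *\<^sub>R (indicator {0<..t} x *\<^sub>R g x)) \<in> borel_measurable lborel"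
    by measurable
  also have "(\<lambda>x. indicator ?A x *\<^sub>R (indicator {0<..t} x *\<^sub>R g x)) = (\<lambda>x. indicator ?A x *\<^sub>R g x)"
    using st by (auto simp: indicator_def)
  finally have mg [measurable]: "(\<lambda>x. indicator ?A x *\<^sub>R g x) \<in> borel_measurable lborel" .
  \<comment> \<open>Both approximations are cut off to \<open>(0, s]\<close>; for the first this changes nothing.\<close>
  define F where "F k x = indicator ?A x *\<^sub>R step_fun (n k) (p k) (c k) x" for k x
  define G where "G k x = indicator ?A x *\<^sub>R step_fun (m k) (q k) (d k) x" for k x
  have F: "F k x = step_fun (n k) (p k) (c k) x" for k x
    using step_fun_eq_0[OF p, of x k "c k"] by (cases "x \<in> ?A") (simp_all add: F_def)
  have [measurable]: "F k \<in> borel_measurable lborel" "G k \<in> borel_measurable lborel" for k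
    unfolding F_def[abs_def] G_def[abs_def] by measurable
  have normA: "ennreal ((norm (indicator ?A x *\<^sub>R a - indicator ?A x *\<^sub>R b))\<^sup>2)
      = ennreal ((norm (a - b))\<^sup>2) * indicator ?A x" for a b :: 'b and x
    by (simp add: indicator_def)
  have limF: "(\<lambda>k. \<integral>\<^sup>+x. ennreal ((norm (F k x - indicator ?A x *\<^sub>R f x))\<^sup>2) \<partial>lborel) \<longlonglongrightarrow> 0"
    unfolding F_def normA by (rule limf)
  have limG: "(\<lambda>k. \<integral>\<^sup>+x. ennreal ((norm (G k x - indicator ?A x *\<^sub>R g x))\<^sup>2) \<partial>lborel) \<longlonglongrightarrow> 0"
  proof (rule tendsto_sandwich[OF _ _ tendsto_const limg])
    show "\<forall>\<^sub>F k in sequentially. (\<integral>\<^sup>+x. ennreal ((norm (G k x - indicator ?A x *\<^sub>R g x))\<^sup>2) \<partial>lborel)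
        \<le> (\<integral>\<^sup>+x\<in>{0<..t}. ennreal ((norm (step_fun (m k) (q k) (d k) x - g x))\<^sup>2) \<partial>lborel)"
      unfolding G_def normA using st
      by (intro always_eventually allI nn_integral_mono mult_left_mono) (auto simp: indicator_def)
  qed simp
  have sqF: "integrable lborel (\<lambda>x. (norm (F k x))\<^sup>2)" for k
    unfolding F using step_integral_isometry(2)[OF B p(1,2) p(1,2)] by (simp add: power2_norm_eq_inner)
  have sqG: "integrable lborel (\<lambda>x. (norm (G k x))\<^sup>2)" for k
  proof (rule Bochner_Integration.integrable_bound)
    show "integrable lborel (\<lambda>x. (norm (step_fun (m k) (q k) (d k) x))\<^sup>2)"
      using step_integral_isometry(2)[OF B q q] by (simp add: power2_norm_eq_inner)
  qed (auto simp: G_def indicator_def)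
  have sqX: "integrable M (\<lambda>\<omega>. (norm (step_integral B (n k) (p k) (c k) \<omega>))\<^sup>2)"
    "integrable M (\<lambda>\<omega>. (norm (step_integral B (m k) (q k) (d k) \<omega>))\<^sup>2)" for k
    using step_integral_isometry(1)[OF B p(1,2) p(1,2)] step_integral_isometry(1)[OF B q q]
    by (simp_all add: power2_eq_square)
  note limits_M = L2_limit_integral_inner[of "\<lambda>k. step_integral B (n k) (p k) (c k)" M X
      "\<lambda>k. step_integral B (m k) (q k) (d k)" Y, OF _ _ _ _ sqX, simplified, OF limX limY]
  note limits_L = L2_limit_integral_inner[of F lborel "\<lambda>x. indicator ?A x *\<^sub>R f x" G
      "\<lambda>x. indicator ?A x *\<^sub>R g x", OF _ _ _ _ sqF sqG limF limG, simplified]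
  have ind: "indicator ?A x *\<^sub>R a \<bullet> indicator ?A x *\<^sub>R b = indicator ?A x *\<^sub>R (a \<bullet> b)" for a b :: 'b and x
    by (simp add: indicator_def)
  have ind2: "indicator ?A x * (indicator ?A x * a) = indicator ?A x * a" for a x :: real
    by (simp add: indicator_def)
  show "integrable M (\<lambda>\<omega>. X \<omega> * Y \<omega>)" using limits_M(1) by simp
  show "set_integrable lborel ?A (\<lambda>u. f u \<bullet> g u)"
    using limits_L(1) by (simp add: set_integrable_def ind2)
  have "(\<integral>\<omega>. step_integral B (n k) (p k) (c k) \<omega> * step_integral B (m k) (q k) (d k) \<omega> \<partial>M)
      = (\<integral>x. F k x \<bullet> G k x \<partial>lborel)" for k
    unfolding step_integral_isometry(3)[OF B p(1,2) q]
  proof (intro Bochner_Integration.integral_cong refl)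
    fix x
    show "step_fun (n k) (p k) (c k) x \<bullet> step_fun (m k) (q k) (d k) x = F k x \<bullet> G k x"
      using F[of k x] by (cases "x \<in> ?A") (auto simp: F_def G_def)
  qed
  with limits_M(2) limits_L(2)
  have "(\<integral>\<omega>. X \<omega> * Y \<omega> \<partial>M) = (\<integral>x. (indicator ?A x *\<^sub>R f x) \<bullet> (indicator ?A x *\<^sub>R g x) \<partial>lborel)"
    using LIMSEQ_unique by simp
  then show "(\<integral>\<omega>. X \<omega> * Y \<omega> \<partial>M) = (LBINT u:?A. f u \<bullet> g u)"
    unfolding ind set_lebesgue_integral_def .
qed

section \<open>Powers of the coupling matrix\<close>

text \<open>In this form the series of \<open>c_fun\<close>, and likewise that of \<open>s_fun\<close>, is uniform in the sign of \<open>\<mu>\<close>: only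
  natural powers of \<open>\<mu>\<close> itself occur. These are the powers that the coupling matrix produces.\<close>

lemma c_fun_sums: "(\<lambda>k. if even k then \<mu> ^ (k div 2) * y ^ k / fact k else 0) sums c_fun \<mu> y"
proof (cases "\<mu> > 0")
  case True
  have "sqrt \<mu> ^ (2 * m) = \<mu> ^ m" for m using True by (simp add: power_mult)
  then have "(\<lambda>k. if even k then (sqrt \<mu> * y) ^ k /\<^sub>R fact k else 0)
      = (\<lambda>k. if even k then \<mu> ^ (k div 2) * y ^ k / fact k else 0)"
    by (intro ext) (auto elim!: evenE simp: power_mult_distrib divide_inverse mult_ac)
  with True cosh_converges[of "sqrt \<mu> * y"] show ?thesis by (simp add: c_fun_def)
next
  case False
  have cf: "(\<lambda>k. cos_coeff k *\<^sub>R (sqrt (-\<mu>) * y) ^ k)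
      = (\<lambda>k. if even k then \<mu> ^ (k div 2) * y ^ k / fact k else 0)"
  proof
    fix k
    show "cos_coeff k *\<^sub>R (sqrt (-\<mu>) * y) ^ k
      = (if even k then \<mu> ^ (k div 2) * y ^ k / fact k else 0)"
    proof (cases "even k")
      case True
      then obtain m where m: "k = 2 * m" by (elim evenE)
      have "sqrt (-\<mu>) ^ (2 * m) = (- \<mu>) ^ m" using False by (simp add: power_mult)
      moreover have "(-1) ^ m * (- \<mu>) ^ m = \<mu> ^ m" by (simp flip: power_mult_distrib)
      ultimately have "(-1) ^ m * (sqrt (-\<mu>) * y) ^ (2 * m) = \<mu> ^ m * y ^ (2 * m)"
        by (simp only: power_mult_distrib mult.assoc[symmetric])
      then show ?thesis by (simp add: m cos_coeff_def)
    qed (simp add: cos_coeff_def)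
  qed
  have "c_fun \<mu> y = cos (sqrt (-\<mu>) * y)" using False by (auto simp: c_fun_def)
  with cos_converges[of "sqrt (-\<mu>) * y"] cf show ?thesis by simp
qed

lemma s_fun_sums: "(\<lambda>k. if even k then 0 else \<mu> ^ (k div 2) * y ^ k / fact k) sums s_fun \<mu> y"
proof -
  consider "\<mu> > 0" | "\<mu> = 0" | "\<mu> < 0" by linarith
  then show ?thesis
  proof cases
    case 1
    have "sqrt \<mu> ^ Suc (2 * m) / sqrt \<mu> = \<mu> ^ m" for m using 1 by (simp add: power_mult)
    then have "(sqrt \<mu> * y) ^ Suc (2 * m) / sqrt \<mu> = \<mu> ^ m * y ^ Suc (2 * m)" for m
      by (metis power_mult_distrib times_divide_eq_left)
    then have "(if even k then 0 else (sqrt \<mu> * y) ^ k /\<^sub>R fact k) / sqrt \<mu>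
      = (if even k then 0 else \<mu> ^ (k div 2) * y ^ k / fact k)" for k
      by (auto elim!: oddE simp del: power_Suc simp: divide_inverse mult_ac)
    with 1 sums_divide[OF sinh_converges[of "sqrt \<mu> * y"], of "sqrt \<mu>"] show ?thesis
      by (simp add: s_fun_def)
  next
    case 2
    have "(\<lambda>k. if even k then 0 else \<mu> ^ (k div 2) * y ^ k / fact k)
        = (\<lambda>k. if k = 1 then y else 0)"
      using 2 by (auto elim!: oddE simp: fun_eq_iff)
    with 2 sums_single[of 1 "\<lambda>_. y"] show ?thesis by (simp add: s_fun_def)
  next
    case 3
    have "sin_coeff k *\<^sub>R (sqrt (-\<mu>) * y) ^ k / sqrt (-\<mu>)
      = (if even k then 0 else \<mu> ^ (k div 2) * y ^ k / fact k)" for k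
    proof (cases "even k")
      case False
      then obtain m where m: "k = 2 * m + 1" by (elim oddE)
      have "sqrt (-\<mu>) ^ (2 * m) = (- \<mu>) ^ m" using 3 by (simp add: power_mult)
      moreover have "(-1) ^ m * (- \<mu>) ^ m = \<mu> ^ m" by (simp flip: power_mult_distrib)
      ultimately have "(-1) ^ m * (sqrt (-\<mu>) * y) ^ (2 * m) = \<mu> ^ m * y ^ (2 * m)"
        by (simp only: power_mult_distrib mult.assoc[symmetric])
      then show ?thesis using 3 by (simp add: m sin_coeff_def)
    qed (simp add: sin_coeff_def)
    with 3 sums_divide[OF sin_converges[of "sqrt (-\<mu>) * y"], of "sqrt (-\<mu>)"] show ?thesis
      by (simp add: s_fun_def)
  qed
qed

text \<open>Since the square of the coupling matrix is \<open>\<alpha>\<^sub>1 * \<alpha>\<^sub>2\<close> times the identity, the even terms of the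
  exponential series are multiples of the identity and the odd ones multiples of the matrix.\<close>

lemma mat_powr_coupling_mat:
  "mat_powr x (coupling_mat \<alpha>\<^sub>1 \<alpha>\<^sub>2)
    = c_fun (\<alpha>\<^sub>1 * \<alpha>\<^sub>2) (ln x) *\<^sub>R mat 1 + s_fun (\<alpha>\<^sub>1 * \<alpha>\<^sub>2) (ln x) *\<^sub>R coupling_mat \<alpha>\<^sub>1 \<alpha>\<^sub>2"
proof -
  define \<mu> where "\<mu> = \<alpha>\<^sub>1 * \<alpha>\<^sub>2"
  define y where "y = ln x"
  let ?A = "coupling_mat \<alpha>\<^sub>1 \<alpha>\<^sub>2"
  have sq: "?A ** ?A = \<mu> *\<^sub>R mat 1"
    by (simp add: vec_eq_iff forall_2 matrix_matrix_mult_def sum_2 coupling_mat_def mat_def \<mu>_def)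
  have sc: "(y *\<^sub>R ?A) ** (a *\<^sub>R C) = (y * a) *\<^sub>R (?A ** C)" for a and C :: "real^2^2"
    by (simp add: vec_eq_iff matrix_matrix_mult_def sum_distrib_left mult_ac)
  have pow: "((**) (y *\<^sub>R ?A) ^^ k) (mat 1)
      = (if even k then (\<mu> ^ (k div 2) * y ^ k) *\<^sub>R mat 1 else (\<mu> ^ (k div 2) * y ^ k) *\<^sub>R ?A)" for k
    by (induction k) (auto simp: sc sq mult_ac elim!: oddE)
  have "(\<lambda>k. (if even k then \<mu> ^ (k div 2) * y ^ k / fact k else 0) *\<^sub>R (mat 1 :: real^2^2)
         + (if even k then 0 else \<mu> ^ (k div 2) * y ^ k / fact k) *\<^sub>R ?A)
      sums (c_fun \<mu> y *\<^sub>R mat 1 + s_fun \<mu> y *\<^sub>R ?A)"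
    by (intro sums_add sums_scaleR_left c_fun_sums s_fun_sums)
  also have "(\<lambda>k. (if even k then \<mu> ^ (k div 2) * y ^ k / fact k else 0) *\<^sub>R (mat 1 :: real^2^2)
         + (if even k then 0 else \<mu> ^ (k div 2) * y ^ k / fact k) *\<^sub>R ?A)
      = (\<lambda>k. ((**) (y *\<^sub>R ?A) ^^ k) (mat 1) /\<^sub>R fact k)"
    by (auto simp: pow fun_eq_iff divide_inverse mult_ac)
  finally show ?thesis
    unfolding mat_powr_def mat_exp_def \<mu>_def y_def by (simp add: sums_iff)
qed

lemma inner_evec_mat_powr:
  "(evec v* mat_powr x (coupling_mat \<alpha>\<^sub>1 \<alpha>\<^sub>2)) \<bullet> (evec v* mat_powr y (coupling_mat \<alpha>\<^sub>1 \<alpha>\<^sub>2))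
   = (c_fun (\<alpha>\<^sub>1 * \<alpha>\<^sub>2) (ln x) - \<alpha>\<^sub>2 * s_fun (\<alpha>\<^sub>1 * \<alpha>\<^sub>2) (ln x))
       * (c_fun (\<alpha>\<^sub>1 * \<alpha>\<^sub>2) (ln y) - \<alpha>\<^sub>2 * s_fun (\<alpha>\<^sub>1 * \<alpha>\<^sub>2) (ln y))
     + (c_fun (\<alpha>\<^sub>1 * \<alpha>\<^sub>2) (ln x) - \<alpha>\<^sub>1 * s_fun (\<alpha>\<^sub>1 * \<alpha>\<^sub>2) (ln x))
       * (c_fun (\<alpha>\<^sub>1 * \<alpha>\<^sub>2) (ln y) - \<alpha>\<^sub>1 * s_fun (\<alpha>\<^sub>1 * \<alpha>\<^sub>2) (ln y))"
  unfolding mat_powr_coupling_mat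
  by (simp add: inner_vec_def vector_matrix_mult_def sum_2 evec_def coupling_mat_def mat_def
      algebra_simps)

section \<open>Calculus of the functions in the covariance\<close>

lemma c_fun_0 [simp]: "c_fun \<mu> 0 = 1" and s_fun_0 [simp]: "s_fun \<mu> 0 = 0"
  by (simp_all add: c_fun_def s_fun_def)

lemma has_real_derivative_c_fun: "(c_fun \<mu> has_real_derivative \<mu> * s_fun \<mu> x) (at x)"
proof -
  consider "\<mu> > 0" | "\<mu> = 0" | "\<mu> < 0" by linarith
  then show ?thesis
  proof cases
    case 1
    then have "c_fun \<mu> = (\<lambda>x. cosh (sqrt \<mu> * x))" by (simp add: c_fun_def fun_eq_iff)
    moreover have "((\<lambda>x. cosh (sqrt \<mu> * x)) has_real_derivative sinh (sqrt \<mu> * x) * sqrt \<mu>) (at x)"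
      by (auto intro!: derivative_eq_intros)
    moreover have "\<mu> * z / sqrt \<mu> = z * sqrt \<mu>" for z
      using real_div_sqrt[of \<mu>] 1 by (metis less_imp_le mult.commute times_divide_eq_right)
    ultimately show ?thesis using 1 by (simp add: s_fun_def)
  next
    case 2
    then have "c_fun \<mu> = (\<lambda>x. 1)" by (simp add: c_fun_def fun_eq_iff)
    with 2 show ?thesis by simp
  next
    case 3
    then have "c_fun \<mu> = (\<lambda>x. cos (sqrt (-\<mu>) * x))" by (simp add: c_fun_def fun_eq_iff)
    moreover have "((\<lambda>x. cos (sqrt (-\<mu>) * x)) has_real_derivative - sin (sqrt (-\<mu>) * x) * sqrt (-\<mu>)) (at x)"
      by (auto intro!: derivative_eq_intros)
    moreover have "\<mu> * z / sqrt (-\<mu>) = - z * sqrt (-\<mu>)" for z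
    proof -
      have "\<mu> * z / sqrt (-\<mu>) = - z * (- \<mu> / sqrt (-\<mu>))" by simp
      also have "\<dots> = - z * sqrt (-\<mu>)" by (subst real_div_sqrt) (use 3 in simp_all)
      finally show ?thesis .
    qed
    ultimately show ?thesis using 3 by (simp add: s_fun_def)
  qed
qed

lemma has_real_derivative_s_fun: "(s_fun \<mu> has_real_derivative c_fun \<mu> x) (at x)"
proof -
  consider "\<mu> > 0" | "\<mu> = 0" | "\<mu> < 0" by linarith
  then show ?thesis
  proof cases
    case 1
    then have "s_fun \<mu> = (\<lambda>x. sinh (sqrt \<mu> * x) / sqrt \<mu>)" by (simp add: s_fun_def fun_eq_iff)
    moreover have "((\<lambda>x. sinh (sqrt \<mu> * x) / sqrt \<mu>) has_real_derivative cosh (sqrt \<mu> * x) * sqrt \<mu> / sqrt \<mu>) (at x)"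
      by (intro DERIV_cdivide) (auto intro!: derivative_eq_intros)
    ultimately show ?thesis using 1 by (simp add: c_fun_def)
  next
    case 2
    then have "s_fun \<mu> = (\<lambda>x. x)" by (simp add: s_fun_def fun_eq_iff)
    with 2 show ?thesis by (simp add: c_fun_def)
  next
    case 3
    then have "s_fun \<mu> = (\<lambda>x. sin (sqrt (-\<mu>) * x) / sqrt (-\<mu>))" by (simp add: s_fun_def fun_eq_iff)
    moreover have "((\<lambda>x. sin (sqrt (-\<mu>) * x) / sqrt (-\<mu>)) has_real_derivative cos (sqrt (-\<mu>) * x) * sqrt (-\<mu>) / sqrt (-\<mu>)) (at x)"
      by (intro DERIV_cdivide) (auto intro!: derivative_eq_intros)
    ultimately show ?thesis using 3 by (simp add: c_fun_def)
  qed
qed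

lemma c_fun_diff: "c_fun \<mu> (x - y) = c_fun \<mu> x * c_fun \<mu> y - \<mu> * (s_fun \<mu> x * s_fun \<mu> y)"
proof -
  consider "\<mu> > 0" | "\<mu> = 0" | "\<mu> < 0" by linarith
  then show ?thesis
    by cases (auto simp: c_fun_def s_fun_def cosh_diff cos_diff right_diff_distrib)
qed

lemma s_fun_add: "s_fun \<mu> (x + y) = s_fun \<mu> x * c_fun \<mu> y + c_fun \<mu> x * s_fun \<mu> y"
proof -
  consider "\<mu> > 0" | "\<mu> = 0" | "\<mu> < 0" by linarith
  then show ?thesis
    by cases (auto simp: c_fun_def s_fun_def sinh_add sin_add distrib_left add_divide_distrib)
qed

text \<open>The rate \<open>\<kappa>\<close> must be smaller than \<open>1/2\<close>, which for \<open>\<mu> > 0\<close> means \<open>sqrt \<mu> < 1/2\<close>; this is what makes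
  the kernels square-integrable at \<open>0\<close>. For \<open>\<mu> \<le> 0\<close> the functions grow at most linearly, and the rate
  \<open>1/4\<close> is an arbitrary choice.\<close>

lemma c_fun_s_fun_bound:
  assumes "\<mu> < 1/4"
  obtains K \<kappa> where "0 < K" "0 < \<kappa>" "\<kappa> < 1/2"
    "\<And>x. 0 \<le> x \<Longrightarrow> \<bar>c_fun \<mu> x\<bar> \<le> K * exp (\<kappa> * x)" "\<And>x. 0 \<le> x \<Longrightarrow> \<bar>s_fun \<mu> x\<bar> \<le> K * exp (\<kappa> * x)"
proof -
  consider "\<mu> > 0" | "\<mu> = 0" | "\<mu> < 0" by linarith
  then show ?thesis
  proof cases
    case 1
    let ?k = "sqrt \<mu>"
    have k: "0 < ?k" "?k < 1/2" using 1 assms real_sqrt_less_mono[OF assms] by (auto simp: real_sqrt_divide)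
    then have k1: "?k \<le> 1" by linarith
    show ?thesis
    proof (rule that[of "1 / ?k" ?k])
      fix x :: real assume x: "0 \<le> x"
      have e: "exp (- (?k * x)) \<le> exp (?k * x)" using x k by simp
      have "\<bar>c_fun \<mu> x\<bar> \<le> exp (?k * x)" using 1 e by (simp add: c_fun_def cosh_def)
      also have "\<dots> \<le> 1 / ?k * exp (?k * x)" using k k1
        by (intro order_trans[OF _ mult_right_mono[of 1 "1 / ?k"]]) (auto simp: le_divide_eq)
      finally show "\<bar>c_fun \<mu> x\<bar> \<le> 1 / ?k * exp (?k * x)" .
      have "- exp (- (?k * x)) \<le> exp (?k * x)" by (rule order_trans[of _ 0]) simp_all
      then have "\<bar>sinh (?k * x)\<bar> \<le> exp (?k * x)" using x k e by (simp add: sinh_def)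
      then show "\<bar>s_fun \<mu> x\<bar> \<le> 1 / ?k * exp (?k * x)" using 1 by (simp add: s_fun_def divide_right_mono)
    qed (use k in auto)
  next
    case 2
    show ?thesis
    proof (rule that[of 4 "1/4"])
      fix x :: real assume x: "0 \<le> x"
      have "1 + 1/4 * x \<le> exp (1/4 * x)" by (rule exp_ge_add_one_self)
      then have "1 \<le> 4 * exp (1/4 * x)" "x \<le> 4 * exp (1/4 * x)" using x by linarith+
      moreover have "\<bar>c_fun \<mu> x\<bar> = 1" "\<bar>s_fun \<mu> x\<bar> = x" using 2 x by (simp_all add: c_fun_def s_fun_def)
      ultimately show "\<bar>c_fun \<mu> x\<bar> \<le> 4 * exp (1/4 * x)" "\<bar>s_fun \<mu> x\<bar> \<le> 4 * exp (1/4 * x)"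
        by simp_all
    qed auto
  next
    case 3
    let ?K = "1 + 1 / sqrt (-\<mu>)"
    show ?thesis
    proof (rule that[of ?K "1/4"])
      show K: "0 < ?K" using 3 by (simp add: add_pos_pos)
      fix x :: real assume x: "0 \<le> x"
      have K1: "?K \<le> ?K * exp (1/4 * x)" using K x by (simp add: mult_le_cancel_left1)
      have "\<bar>c_fun \<mu> x\<bar> \<le> 1" using 3 by (simp add: c_fun_def)
      also have "1 \<le> ?K" using 3 by simp
      finally show "\<bar>c_fun \<mu> x\<bar> \<le> ?K * exp (1/4 * x)" using K1 by linarith
      have "\<bar>s_fun \<mu> x\<bar> \<le> 1 / sqrt (-\<mu>)" using 3 by (simp add: s_fun_def divide_right_mono)
      then show "\<bar>s_fun \<mu> x\<bar> \<le> ?K * exp (1/4 * x)" using K1 by linarith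
    qed auto
  qed
qed


section \<open>Integrals of products of two kernels\<close>

text \<open>The integrands of interest may be unbounded at \<open>0\<close>; their integrability comes from the isometry,
  and so a one-sided limit of the antiderivative suffices there.\<close>

lemma integral_eq_of_antiderivative_at_0:
  fixes f F :: "real \<Rightarrow> real"
  assumes r: "0 < r"
    and F: "\<And>u. 0 < u \<Longrightarrow> u \<le> r \<Longrightarrow> (F has_real_derivative f u) (at u)"
    and cont: "\<And>u. 0 < u \<Longrightarrow> u \<le> r \<Longrightarrow> isCont f u"
    and int: "set_integrable lborel {0<..r} f"
    and lim: "(F \<longlongrightarrow> 0) (at_right 0)"
  shows "(LBINT u:{0<..r}. f u) = F r"
proof -
  have "(LBINT u=ereal 0..ereal r. f u) = F r - 0"
  proof (rule interval_integral_FTC_integrable)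
    show "set_integrable lborel (einterval (ereal 0) (ereal r)) f"
      by (rule set_integrable_subset[OF int]) auto
    show "((F \<circ> real_of_ereal) \<longlongrightarrow> 0) (at_right (ereal 0))"
      unfolding comp_def by (rule lim[folded ereal_tendsto_simps1(2)[unfolded comp_def]])
    have "isCont F r" using F[of r] r by (auto intro: DERIV_isCont)
    then have "(F \<longlongrightarrow> F r) (at_left r)"
      by (auto simp: isCont_def filterlim_at_split)
    then show "((F \<circ> real_of_ereal) \<longlongrightarrow> F r) (at_left (ereal r))"
      by (simp add: ereal_tendsto_simps1)
  qed (use r F cont in \<open>auto simp flip: has_real_derivative_iff_has_vector_derivative\<close>)
  then have "(LBINT u:{0<..<r}. f u) = F r" using r by (simp add: interval_lebesgue_integral_def)
  also have "(LBINT u:{0<..<r}. f u) = (LBINT u:{0<..r}. f u)"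
  proof (rule set_integral_cong_set)
    show "set_borel_measurable lborel {0<..<r} f"
    proof -
      have "set_integrable lborel {0<..<r} f" by (rule set_integrable_subset[OF int]) auto
      then show ?thesis by (auto simp: set_integrable_def set_borel_measurable_def)
    qed
    show "set_borel_measurable lborel {0<..r} f"
      using int by (auto simp: set_integrable_def set_borel_measurable_def)
    show "AE x in lborel. (x \<in> {0<..r}) = (x \<in> {0<..<r})"
      using AE_lborel_singleton[of r] by (auto elim!: eventually_mono)
  qed
  finally show ?thesis .
qed

lemma has_real_derivative_ln_ratio:
  fixes a u :: real
  assumes "0 < a" "0 < u"
  shows "((\<lambda>u. ln (a / u)) has_real_derivative - 1 / u) (at u)"
  using assms by (auto intro!: derivative_eq_intros simp: field_simps)

text \<open>The function is a constant times \<open>u powr (1 - 2 * \<kappa>)\<close>, and the exponent is positive.\<close>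

lemma tendsto_ratio_growth_at_0:
  fixes a b \<kappa> :: real
  assumes "0 < a" "0 < b" "\<kappa> < 1/2"
  shows "((\<lambda>u. u * exp (\<kappa> * (ln (a / u) + ln (b / u)))) \<longlongrightarrow> 0) (at_right 0)"
proof -
  have "filterlim (\<lambda>u. (1 - 2 * \<kappa>) * ln u) at_bot (at_right (0::real))"
    by (rule filterlim_tendsto_pos_mult_at_bot[OF tendsto_const _ ln_at_0]) (use assms in simp)
  then have "((\<lambda>u. exp ((1 - 2 * \<kappa>) * ln u)) \<longlongrightarrow> 0) (at_right (0::real))"
    by (rule filterlim_compose[OF exp_at_bot])
  then have "((\<lambda>u. exp (\<kappa> * (ln a + ln b)) * exp ((1 - 2 * \<kappa>) * ln u)) \<longlongrightarrow> 0) (at_right 0)"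
    by (rule tendsto_mult_right_zero)
  moreover have "\<forall>\<^sub>F u in at_right 0. exp (\<kappa> * (ln a + ln b)) * exp ((1 - 2 * \<kappa>) * ln u)
      = u * exp (\<kappa> * (ln (a / u) + ln (b / u)))"
  proof (rule eventually_at_rightI[of 0 1])
    fix u :: real assume u: "u \<in> {0<..<1}"
    have "exp (\<kappa> * (ln a + ln b)) * exp ((1 - 2 * \<kappa>) * ln u)
        = exp (ln u + \<kappa> * (ln (a / u) + ln (b / u)))"
      using assms u by (simp add: ln_div algebra_simps flip: exp_add)
    also have "\<dots> = u * exp (\<kappa> * (ln (a / u) + ln (b / u)))" using u by (simp add: exp_add)
    finally show "exp (\<kappa> * (ln a + ln b)) * exp ((1 - 2 * \<kappa>) * ln u)
        = u * exp (\<kappa> * (ln (a / u) + ln (b / u)))" .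
  qed simp
  ultimately show ?thesis by (rule Lim_transform_eventually)
qed

text \<open>The function \<open>P\<close> of the proof is the antiderivative of the kernel product. With
  \<open>x = ln (r / u)\<close> and \<open>y = ln (q / u)\<close>, its three summands account for
  the constant part \<open>2 c(y - x)\<close>, the product \<open>s(x) s(y)\<close> and the remaining multiple of \<open>s(x + y)\<close>, the
  last with the factor \<open>\<nu>\<^sup>2 - \<nu>\<close> because the second one leaves \<open>- \<nu>\<^sup>2 s(x + y)\<close> behind.\<close>

lemma integral_coupled_kernel:
  fixes \<alpha>\<^sub>1 \<alpha>\<^sub>2 \<mu> \<nu> r q :: real
  assumes mu: "\<mu> = \<alpha>\<^sub>1 * \<alpha>\<^sub>2" "\<mu> < 1/4" and nu: "\<nu> = \<alpha>\<^sub>1 + \<alpha>\<^sub>2" and rq: "0 < r" "r \<le> q"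
  defines "f \<equiv> \<lambda>u. (c_fun \<mu> (ln (r / u)) - \<alpha>\<^sub>2 * s_fun \<mu> (ln (r / u)))
                    * (c_fun \<mu> (ln (q / u)) - \<alpha>\<^sub>2 * s_fun \<mu> (ln (q / u)))
                + (c_fun \<mu> (ln (r / u)) - \<alpha>\<^sub>1 * s_fun \<mu> (ln (r / u)))
                    * (c_fun \<mu> (ln (q / u)) - \<alpha>\<^sub>1 * s_fun \<mu> (ln (q / u)))"
  assumes int: "set_integrable lborel {0<..r} f"
  shows "(LBINT u:{0<..r}. f u) = 2 * r * c_fun \<mu> (ln (q / r))
    - \<nu> * (1 - \<nu>) / (1 - 4 * \<mu>) * (r * (2 * c_fun \<mu> (ln (q / r)) + s_fun \<mu> (ln (q / r))))"
proof -
  have q: "0 < q" using rq by simp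
  define lam where "lam = \<nu> * (1 - \<nu>) / (1 - 4 * \<mu>)"
  have lam: "lam * (1 - 4 * \<mu>) = \<nu> * (1 - \<nu>)" using mu by (simp add: lam_def)
  define z where "z u = ln (r / u) + ln (q / u)" for u
  define P where "P u = 2 * c_fun \<mu> (ln (q / r)) * u
      + \<nu>\<^sup>2 * (u * (s_fun \<mu> (ln (r / u)) * s_fun \<mu> (ln (q / u))))
      - lam * (u * (2 * c_fun \<mu> (z u) + s_fun \<mu> (z u)))" for u
  have dz: "(z has_real_derivative - 2 / u) (at u)" if "0 < u" for u
    using DERIV_add[OF has_real_derivative_ln_ratio[OF rq(1) that] has_real_derivative_ln_ratio[OF q that]]
    by (simp add: z_def[abs_def])
  have ds: "((\<lambda>u. s_fun \<mu> (ln (a / u))) has_real_derivative c_fun \<mu> (ln (a / u)) * (- 1 / u)) (at u)"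
    if "0 < a" "0 < u" for a u
    by (rule DERIV_chain2[OF has_real_derivative_s_fun has_real_derivative_ln_ratio[OF that]])
  have dc: "((\<lambda>u. c_fun \<mu> (ln (a / u))) has_real_derivative \<mu> * s_fun \<mu> (ln (a / u)) * (- 1 / u)) (at u)"
    if "0 < a" "0 < u" for a u
    by (rule DERIV_chain2[OF has_real_derivative_c_fun has_real_derivative_ln_ratio[OF that]])
  have "(LBINT u:{0<..r}. f u) = P r"
  proof (rule integral_eq_of_antiderivative_at_0[OF rq(1) _ _ int])
    fix u assume u: "0 < u" "u \<le> r"
    note d = ds[OF rq(1) u(1)] ds[OF q u(1)]
      DERIV_chain2[OF has_real_derivative_c_fun dz[OF u(1)]]
      DERIV_chain2[OF has_real_derivative_s_fun dz[OF u(1)]]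
    define C1 C2 S1 S2 where CS: "C1 = c_fun \<mu> (ln (r / u))" "C2 = c_fun \<mu> (ln (q / u))"
      "S1 = s_fun \<mu> (ln (r / u))" "S2 = s_fun \<mu> (ln (q / u))"
    \<comment> \<open>The addition theorems express all terms through the values at \<open>ln (r / u)\<close> and \<open>ln (q / u)\<close>, except for \<open>c(z)\<close>, which cancels.\<close>
    have "ln (q / r) = ln (q / u) - ln (r / u)" using rq q u by (simp add: ln_div)
    then have L: "c_fun \<mu> (ln (q / r)) = C1 * C2 - \<mu> * (S1 * S2)"
      by (simp add: c_fun_diff CS mult_ac)
    have Z: "s_fun \<mu> (z u) = S1 * C2 + C1 * S2" by (simp add: z_def s_fun_add CS)
    have "(P has_real_derivative 2 * c_fun \<mu> (ln (q / r))
        + \<nu>\<^sup>2 * (S1 * S2 + u * (S1 * (C2 * (-1 / u)) + C1 * (-1 / u) * S2))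
        - lam * ((2 * c_fun \<mu> (z u) + s_fun \<mu> (z u))
            + u * (2 * (\<mu> * s_fun \<mu> (z u) * (-2 / u)) + c_fun \<mu> (z u) * (-2 / u)))) (at u)"
      unfolding P_def[abs_def] CS
      by (rule derivative_eq_intros d refl)+ (simp add: algebra_simps)
    also have "2 * c_fun \<mu> (ln (q / r))
        + \<nu>\<^sup>2 * (S1 * S2 + u * (S1 * (C2 * (-1 / u)) + C1 * (-1 / u) * S2))
        - lam * ((2 * c_fun \<mu> (z u) + s_fun \<mu> (z u))
            + u * (2 * (\<mu> * s_fun \<mu> (z u) * (-2 / u)) + c_fun \<mu> (z u) * (-2 / u)))
        = 2 * c_fun \<mu> (ln (q / r)) + \<nu>\<^sup>2 * (S1 * S2 - (S1 * C2 + C1 * S2))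
          - (lam * (1 - 4 * \<mu>)) * s_fun \<mu> (z u)"
      using u by (simp add: field_simps)
    also have "\<dots> = (C1 - \<alpha>\<^sub>2 * S1) * (C2 - \<alpha>\<^sub>2 * S2) + (C1 - \<alpha>\<^sub>1 * S1) * (C2 - \<alpha>\<^sub>1 * S2)"
      unfolding lam L Z unfolding nu mu(1)
      by (simp add: algebra_simps power2_eq_square)
    also have "\<dots> = f u" by (simp add: f_def CS)
    finally show "(P has_real_derivative f u) (at u)" .
    note cont = ds[OF rq(1) u(1), THEN DERIV_isCont] ds[OF q u(1), THEN DERIV_isCont]
      dc[OF rq(1) u(1), THEN DERIV_isCont] dc[OF q u(1), THEN DERIV_isCont]
    show "isCont f u" unfolding f_def by (intro continuous_intros cont)
  next
    obtain K \<kappa> where K: "0 < K" "0 < \<kappa>" "\<kappa> < 1/2"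
      and bc: "\<And>x. 0 \<le> x \<Longrightarrow> \<bar>c_fun \<mu> x\<bar> \<le> K * exp (\<kappa> * x)"
      and bs: "\<And>x. 0 \<le> x \<Longrightarrow> \<bar>s_fun \<mu> x\<bar> \<le> K * exp (\<kappa> * x)"
      using c_fun_s_fun_bound[OF mu(2)] by metis
    let ?E = "\<lambda>u. u * exp (\<kappa> * (ln (r / u) + ln (q / u)))"
    have E: "(?E \<longlongrightarrow> 0) (at_right 0)" by (rule tendsto_ratio_growth_at_0[OF rq(1) q K(3)])
    \<comment> \<open>Apart from the multiple of \<open>u\<close>, each summand of \<open>P\<close> is a multiple of some \<open>u * g u\<close>
      where \<open>g\<close> grows at the rate \<open>\<kappa>\<close> in \<open>z\<close>.\<close>
    have null: "((\<lambda>u. u * g u) \<longlongrightarrow> 0) (at_right 0)"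
      if g: "\<And>u. 0 < u \<Longrightarrow> u < r \<Longrightarrow> \<bar>g u\<bar> \<le> D * exp (\<kappa> * z u)" for g D
    proof (rule Lim_null_comparison)
      show "\<forall>\<^sub>F u in at_right 0. norm (u * g u) \<le> D * ?E u"
      proof (rule eventually_at_rightI[of 0 r])
        fix u assume "u \<in> {0<..<r}"
        then show "norm (u * g u) \<le> D * ?E u"
          using mult_left_mono[OF g[of u], of u] by (simp add: abs_mult z_def mult_ac)
      qed (use rq in simp)
      show "((\<lambda>u. D * ?E u) \<longlongrightarrow> 0) (at_right 0)" by (rule tendsto_mult_right_zero[OF E])
    qed
    have pos: "0 \<le> ln (r / u)" "0 \<le> ln (q / u)" "0 \<le> z u" if "0 < u" "u < r" for u
      using that rq by (simp_all add: z_def)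
    have n1: "((\<lambda>u. u * (s_fun \<mu> (ln (r / u)) * s_fun \<mu> (ln (q / u)))) \<longlongrightarrow> 0) (at_right 0)"
    proof (rule null)
      fix u assume u: "0 < u" "u < r"
      have "\<bar>s_fun \<mu> (ln (r / u)) * s_fun \<mu> (ln (q / u))\<bar>
          \<le> (K * exp (\<kappa> * ln (r / u))) * (K * exp (\<kappa> * ln (q / u)))"
        unfolding abs_mult using K by (intro mult_mono bs pos u) auto
      also have "\<dots> = K\<^sup>2 * exp (\<kappa> * z u)"
        by (simp add: z_def distrib_left exp_add power2_eq_square)
      finally show "\<bar>s_fun \<mu> (ln (r / u)) * s_fun \<mu> (ln (q / u))\<bar> \<le> K\<^sup>2 * exp (\<kappa> * z u)" .
    qed
    have n2: "((\<lambda>u. u * (2 * c_fun \<mu> (z u) + s_fun \<mu> (z u))) \<longlongrightarrow> 0) (at_right 0)"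
    proof (rule null)
      fix u assume u: "0 < u" "u < r"
      show "\<bar>2 * c_fun \<mu> (z u) + s_fun \<mu> (z u)\<bar> \<le> (3 * K) * exp (\<kappa> * z u)"
        using bc[OF pos(3)[OF u]] bs[OF pos(3)[OF u]] by linarith
    qed
    have "(P \<longlongrightarrow> 2 * c_fun \<mu> (ln (q / r)) * 0 + \<nu>\<^sup>2 * 0 - lam * 0) (at_right 0)"
      unfolding P_def[abs_def] by (intro tendsto_intros n1 n2)
    then show "(P \<longlongrightarrow> 0) (at_right 0)" by simp
  qed
  then show ?thesis using rq by (simp add: P_def z_def lam_def)
qed

lemma integral_power_kernel:
  fixes \<alpha> r q :: real
  assumes \<alpha>: "- 1/2 < \<alpha>" and rq: "0 < r" "r \<le> q"
    and int: "set_integrable lborel {0<..r} (\<lambda>u. (r / u) powr (- \<alpha>) * (q / u) powr (- \<alpha>))"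
  shows "(LBINT u:{0<..r}. (r / u) powr (- \<alpha>) * (q / u) powr (- \<alpha>)) = r / (1 + 2 * \<alpha>) * (q / r) powr (- \<alpha>)"
proof -
  define k where "k = (r * q) powr (- \<alpha>)"
  have q: "0 < q" using rq by simp
  have e: "(r / u) powr (- \<alpha>) * (q / u) powr (- \<alpha>) = k * u powr (2 * \<alpha>)" if "0 < u" for u
    using that rq q by (simp add: k_def powr_def ln_div ln_mult algebra_simps flip: exp_add)
  have "(LBINT u:{0<..r}. (r / u) powr (- \<alpha>) * (q / u) powr (- \<alpha>)) = k * (r powr (1 + 2 * \<alpha>) / (1 + 2 * \<alpha>))"
  proof (rule integral_eq_of_antiderivative_at_0[OF rq(1) _ _ int])
    fix u assume u: "0 < u" "u \<le> r"
    show "((\<lambda>u. k * (u powr (1 + 2 * \<alpha>) / (1 + 2 * \<alpha>))) has_real_derivative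
        (r / u) powr (- \<alpha>) * (q / u) powr (- \<alpha>)) (at u)"
    proof -
      have "((\<lambda>u. k * (u powr (1 + 2 * \<alpha>) / (1 + 2 * \<alpha>))) has_real_derivative
          k * ((1 + 2 * \<alpha>) * u powr (1 + 2 * \<alpha> - 1) / (1 + 2 * \<alpha>))) (at u)"
        by (intro DERIV_cmult DERIV_cdivide has_real_derivative_powr u)
      then show ?thesis unfolding e[OF u(1)] using \<alpha> by simp
    qed
    show "isCont (\<lambda>u. (r / u) powr (- \<alpha>) * (q / u) powr (- \<alpha>)) u"
      using u rq q by (intro continuous_intros) auto
  next
    have "((\<lambda>u. u powr (1 + 2 * \<alpha>)) \<longlongrightarrow> 0) (at_right (0::real))"
      using \<alpha> by (intro tendsto_zero_powrI[OF _ tendsto_const]) (auto intro: tendsto_ident_at eventually_at_right_less[THEN eventually_mono])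
    then show "((\<lambda>u. k * (u powr (1 + 2 * \<alpha>) / (1 + 2 * \<alpha>))) \<longlongrightarrow> 0) (at_right 0)"
      by (intro tendsto_mult_right_zero tendsto_divide_zero)
  qed
  also have "k * r powr (1 + 2 * \<alpha>) = r * (q / r) powr (- \<alpha>)"
  proof -
    have "k * r powr (1 + 2 * \<alpha>) = exp (ln r + (- \<alpha>) * (ln q - ln r))"
      using rq q by (simp add: k_def powr_def ln_mult algebra_simps flip: exp_add)
    also have "\<dots> = r * (q / r) powr (- \<alpha>)" unfolding exp_add using rq q by (simp add: powr_def ln_div)
    finally show ?thesis .
  qed
  then have "k * (r powr (1 + 2 * \<alpha>) / (1 + 2 * \<alpha>)) = r / (1 + 2 * \<alpha>) * (q / r) powr (- \<alpha>)"
    by (simp add: mult_ac)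
  finally show ?thesis .
qed

text \<open>For \<open>\<mu> = \<alpha>\<^sup>2\<close> the number \<open>\<alpha>\<close> is a square root of \<open>\<mu>\<close>, possibly the negative one; as \<open>cosh\<close> is even and
  \<open>sinh\<close> odd, the sign cancels and the identity is \<open>cosh - sinh = exp (- _)\<close>.\<close>

lemma c_fun_minus_s_fun_square: "c_fun (\<alpha> * \<alpha>) x - \<alpha> * s_fun (\<alpha> * \<alpha>) x = exp (- (\<alpha> * x))"
proof (cases "\<alpha> = 0")
  case False
  then have "c_fun (\<alpha> * \<alpha>) x = cosh (\<alpha> * x)" "\<alpha> * s_fun (\<alpha> * \<alpha>) x = sinh (\<alpha> * x)"
    by (cases "\<alpha> > 0"; simp add: c_fun_def s_fun_def zero_less_mult_iff)+
  then show ?thesis by (simp add: cosh_minus_sinh)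
qed (simp add: c_fun_def)

section \<open>The covariance kernel\<close>

theorem proposition5p3:
  fixes \<alpha>\<^sub>1 \<alpha>\<^sub>2 \<mu> \<nu> lam :: real
    and M :: "'a measure"
    and V :: "real \<Rightarrow> 'a \<Rightarrow> real"
  assumes "\<alpha>\<^sub>1 \<in> {-1..1}" and "\<alpha>\<^sub>2 \<in> {-1..1}"
    and "\<mu> = \<alpha>\<^sub>1 * \<alpha>\<^sub>2"
    and "\<nu> = \<alpha>\<^sub>1 + \<alpha>\<^sub>2"
    and "lam = \<nu> * (1 - \<nu>) / (1 - 4 * \<mu>)"
    and "\<mu> < 1/4 \<or> (\<alpha>\<^sub>1 = \<alpha>\<^sub>2 \<and> \<alpha>\<^sub>1 \<in> {1/2..<1})"
    and "process_V \<alpha>\<^sub>1 \<alpha>\<^sub>2 M V"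
  shows
    "(\<forall>s\<ge>0. \<forall>t\<ge>0. integrable M (\<lambda>\<omega>. V s \<omega> * V t \<omega>)) \<and>
     (\<mu> < 1/4 \<longrightarrow>
        (\<forall>s>0. \<forall>t>0. let r = min s t; q = max s t in
           prob_space.expectation M (\<lambda>\<omega>. V s \<omega> * V t \<omega>)
             = 2 * r * c_fun \<mu> (ln (q / r)) - lam * C_kernel \<mu> s t)) \<and>
     (\<alpha>\<^sub>1 = \<alpha>\<^sub>2 \<and> \<alpha>\<^sub>1 \<in> {-1/2<..<1} \<longrightarrow>
        (\<forall>s t. 0 < s \<and> s \<le> t \<longrightarrow>
           prob_space.expectation M (\<lambda>\<omega>. V s \<omega> * V t \<omega>)
             = 2 * s / (1 + 2 * \<alpha>\<^sub>1) * (t / s) powr (- \<alpha>\<^sub>1))) \<and>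
     (\<forall>t\<ge>0.
        (\<mu> < 1/4 \<longrightarrow>
           prob_space.expectation M (\<lambda>\<omega>. (V t \<omega>)\<^sup>2)
             = 2 * t * (1 - \<alpha>\<^sub>1 - \<alpha>\<^sub>2 + (\<alpha>\<^sub>1 - \<alpha>\<^sub>2)\<^sup>2) / (1 - 4 * \<alpha>\<^sub>1 * \<alpha>\<^sub>2)) \<and>
        (\<alpha>\<^sub>1 = \<alpha>\<^sub>2 \<and> \<alpha>\<^sub>1 \<in> {1/2..<1} \<longrightarrow>
           prob_space.expectation M (\<lambda>\<omega>. (V t \<omega>)\<^sup>2) = 2 * t / (1 + 2 * \<alpha>\<^sub>1)))"
proof -
  have P: "prob_space M" and G: "centered_gaussian_process M V" and V0: "AE \<omega> in M. V 0 \<omega> = 0"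
    and caseA: "\<alpha>\<^sub>1 * \<alpha>\<^sub>2 < 1/4 \<longrightarrow>
        (\<exists>B :: real \<Rightarrow> 'a \<Rightarrow> real ^ 2. brownian_motion M B \<and>
           (\<forall>t>0. has_wiener_integral M B t
              (\<lambda>s. evec v* mat_powr (t / s) (coupling_mat \<alpha>\<^sub>1 \<alpha>\<^sub>2)) (V t)))"
    and caseB: "\<alpha>\<^sub>1 = \<alpha>\<^sub>2 \<and> \<alpha>\<^sub>1 \<in> {1/2..<1} \<longrightarrow>
        (\<exists>W :: real \<Rightarrow> 'a \<Rightarrow> real. brownian_motion M W \<and>
           (\<forall>t>0. \<exists>I. has_wiener_integral M W t (\<lambda>s. (t / s) powr (- \<alpha>\<^sub>1)) I \<and>
              (AE \<omega> in M. V t \<omega> = sqrt 2 * I \<omega>)))"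
    using assms(7) unfolding process_V_def by - (elim conjE, assumption)+
  interpret prob_space M by (rule P)
  have mV: "V t \<in> borel_measurable M" if "0 \<le> t" for t
  proof -
    have "centered_gaussian M (V t)"
      using G[unfolded centered_gaussian_process_def, rule_format, of 1 "\<lambda>_. t" "\<lambda>_. 1"] that by simp
    then show ?thesis by (simp add: centered_gaussian_def)
  qed
  \<comment> \<open>It suffices to treat \<open>s \<le> t\<close>, since the covariance is symmetric.\<close>
  have gen: "integrable M (\<lambda>\<omega>. V s \<omega> * V t \<omega>) \<and>
      (\<mu> < 1/4 \<longrightarrow> expectation (\<lambda>\<omega>. V s \<omega> * V t \<omega>)
         = 2 * s * c_fun \<mu> (ln (t / s)) - lam * (s * (2 * c_fun \<mu> (ln (t / s)) + s_fun \<mu> (ln (t / s))))) \<and>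
      (\<alpha>\<^sub>1 = \<alpha>\<^sub>2 \<and> \<alpha>\<^sub>1 \<in> {-1/2<..<1} \<longrightarrow> expectation (\<lambda>\<omega>. V s \<omega> * V t \<omega>)
         = 2 * s / (1 + 2 * \<alpha>\<^sub>1) * (t / s) powr (- \<alpha>\<^sub>1))"
    if s: "0 < s" and st: "s \<le> t" for s t
  proof (cases "\<mu> < 1/4")
    case True
    have t: "0 < t" using s st by simp
    obtain B :: "real \<Rightarrow> 'a \<Rightarrow> real ^ 2" where B: "brownian_motion M B"
      and VB: "\<And>t. t > 0 \<Longrightarrow> has_wiener_integral M B t
              (\<lambda>s. evec v* mat_powr (t / s) (coupling_mat \<alpha>\<^sub>1 \<alpha>\<^sub>2)) (V t)"
      using caseA True assms(3) by auto
    note iso = wiener_integral_isometry[OF B VB[OF s] VB[OF t] st,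
        unfolded inner_evec_mat_powr, folded assms(3)]
    have cov: "expectation (\<lambda>\<omega>. V s \<omega> * V t \<omega>)
         = 2 * s * c_fun \<mu> (ln (t / s)) - lam * (s * (2 * c_fun \<mu> (ln (t / s)) + s_fun \<mu> (ln (t / s))))"
      unfolding iso(3) assms(5)
      by (rule integral_coupled_kernel[OF assms(3) True assms(4) s st iso(2)])
    moreover have "2 * s * c_fun \<mu> (ln (t / s)) - lam * (s * (2 * c_fun \<mu> (ln (t / s)) + s_fun \<mu> (ln (t / s))))
        = 2 * s / (1 + 2 * \<alpha>\<^sub>1) * (t / s) powr (- \<alpha>\<^sub>1)" if \<alpha>: "\<alpha>\<^sub>1 = \<alpha>\<^sub>2" "\<alpha>\<^sub>1 \<in> {-1/2<..<1}"
    proof -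
      let ?c = "c_fun \<mu> (ln (t / s))" and ?s = "s_fun \<mu> (ln (t / s))"
      have ne: "1 + 2 * \<alpha>\<^sub>1 \<noteq> 0" using \<alpha> by auto
      \<comment> \<open>The factor \<open>1 - 2 * \<alpha>\<^sub>1\<close> of \<open>1 - 4 * \<mu>\<close> cancels against \<open>1 - \<nu>\<close>.\<close>
      have fac: "1 - 4 * \<mu> = (1 - 2 * \<alpha>\<^sub>1) * (1 + 2 * \<alpha>\<^sub>1)" using assms(3) \<alpha> by (simp add: algebra_simps)
      then have ne2: "1 - 2 * \<alpha>\<^sub>1 \<noteq> 0" using True by auto
      have "\<nu> * (1 - \<nu>) = (1 - 2 * \<alpha>\<^sub>1) * (2 * \<alpha>\<^sub>1)" using assms(4) \<alpha>(1) by simp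
      then have lam: "lam = 2 * \<alpha>\<^sub>1 / (1 + 2 * \<alpha>\<^sub>1)"
        unfolding assms(5) fac by (simp only: mult_divide_mult_cancel_left[OF ne2])
      have "2 * s * ?c - lam * (s * (2 * ?c + ?s)) = 2 * s / (1 + 2 * \<alpha>\<^sub>1) * (?c - \<alpha>\<^sub>1 * ?s)"
        unfolding lam using ne by (simp add: field_simps)
      also have "?c - \<alpha>\<^sub>1 * ?s = (t / s) powr (- \<alpha>\<^sub>1)"
        using c_fun_minus_s_fun_square[of \<alpha>\<^sub>1] s t assms(3) \<alpha>(1) by (simp add: powr_def)
      finally show ?thesis .
    qed
    ultimately show ?thesis using iso(1) by auto
  next
    case False
    have t: "0 < t" using s st by simp
    have \<alpha>: "\<alpha>\<^sub>1 = \<alpha>\<^sub>2" "\<alpha>\<^sub>1 \<in> {1/2..<1}" using False assms(6) by auto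
    obtain W :: "real \<Rightarrow> 'a \<Rightarrow> real" where W: "brownian_motion M W"
      and VW: "\<And>t. t > 0 \<Longrightarrow> \<exists>I. has_wiener_integral M W t (\<lambda>s. (t / s) powr (- \<alpha>\<^sub>1)) I \<and>
              (AE \<omega> in M. V t \<omega> = sqrt 2 * I \<omega>)"
      using caseB \<alpha> by auto
    obtain I J where I: "has_wiener_integral M W s (\<lambda>u. (s / u) powr (- \<alpha>\<^sub>1)) I" "AE \<omega> in M. V s \<omega> = sqrt 2 * I \<omega>"
      and J: "has_wiener_integral M W t (\<lambda>u. (t / u) powr (- \<alpha>\<^sub>1)) J" "AE \<omega> in M. V t \<omega> = sqrt 2 * J \<omega>"
      using VW[OF s] VW[OF t] by blast
    note iso = wiener_integral_isometry[OF W I(1) J(1) st, unfolded inner_real_def]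
    have [measurable]: "I \<in> borel_measurable M" "J \<in> borel_measurable M" "V s \<in> borel_measurable M"
      "V t \<in> borel_measurable M"
      using I(1) J(1) mV s t by (simp_all add: has_wiener_integral_def)
    have ae: "AE \<omega> in M. V s \<omega> * V t \<omega> = 2 * (I \<omega> * J \<omega>)"
      using I(2) J(2) by eventually_elim simp
    have "integrable M (\<lambda>\<omega>. V s \<omega> * V t \<omega>)"
      by (subst integrable_cong_AE[OF _ _ ae]) (use iso(1) in simp_all)
    moreover have "expectation (\<lambda>\<omega>. V s \<omega> * V t \<omega>) = 2 * expectation (\<lambda>\<omega>. I \<omega> * J \<omega>)"
      by (subst integral_cong_AE[OF _ _ ae]) simp_all
    moreover have "expectation (\<lambda>\<omega>. I \<omega> * J \<omega>) = s / (1 + 2 * \<alpha>\<^sub>1) * (t / s) powr (- \<alpha>\<^sub>1)"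
      unfolding iso(3) by (rule integral_power_kernel[OF _ s st iso(2)]) (use \<alpha> in simp)
    ultimately show ?thesis using False by simp
  qed
  have zero: "integrable M (\<lambda>\<omega>. V s \<omega> * V t \<omega>) \<and> expectation (\<lambda>\<omega>. V s \<omega> * V t \<omega>) = 0"
    if "0 \<le> s" "0 \<le> t" "s = 0 \<or> t = 0" for s t
  proof -
    have [measurable]: "V s \<in> borel_measurable M" "V t \<in> borel_measurable M" using mV that by simp_all
    have ae: "AE \<omega> in M. V s \<omega> * V t \<omega> = 0" using V0 that(3) by (auto elim: eventually_mono)
    show ?thesis
      using integrable_cong_AE[OF _ _ ae] integral_cong_AE[OF _ _ ae] by simp
  qed
  have int: "integrable M (\<lambda>\<omega>. V s \<omega> * V t \<omega>)" if "0 \<le> s" "0 \<le> t" for s t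
  proof -
    consider "s = 0 \<or> t = 0" | "0 < s" "s \<le> t" | "0 < t" "t \<le> s" using \<open>0 \<le> s\<close> \<open>0 \<le> t\<close> by linarith
    then show ?thesis
    proof cases
      case 1
      then show ?thesis using zero that by blast
    next
      case 2
      then show ?thesis using gen by blast
    next
      case 3
      then show ?thesis using gen[of t s] by (simp add: mult.commute)
    qed
  qed
  have cov: "let r = min s t; q = max s t in
       expectation (\<lambda>\<omega>. V s \<omega> * V t \<omega>) = 2 * r * c_fun \<mu> (ln (q / r)) - lam * C_kernel \<mu> s t"
    if "\<mu> < 1/4" "0 < s" "0 < t" for s t
    using gen[of s t] gen[of t s] that
    by (cases "s \<le> t") (auto simp: C_kernel_def Let_def min_def max_def mult.commute[of "V t _"])
  have var: "(\<mu> < 1/4 \<longrightarrow> expectation (\<lambda>\<omega>. (V t \<omega>)\<^sup>2)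
             = 2 * t * (1 - \<alpha>\<^sub>1 - \<alpha>\<^sub>2 + (\<alpha>\<^sub>1 - \<alpha>\<^sub>2)\<^sup>2) / (1 - 4 * \<alpha>\<^sub>1 * \<alpha>\<^sub>2)) \<and>
        (\<alpha>\<^sub>1 = \<alpha>\<^sub>2 \<and> \<alpha>\<^sub>1 \<in> {1/2..<1} \<longrightarrow>
           expectation (\<lambda>\<omega>. (V t \<omega>)\<^sup>2) = 2 * t / (1 + 2 * \<alpha>\<^sub>1))" if "0 \<le> t" for t
  proof (cases "t = 0")
    case True
    then show ?thesis using zero[of 0 0] by (simp add: power2_eq_square)
  next
    case False
    then have t: "0 < t" using that by simp
    have "2 * t - lam * (t * 2) = 2 * t * (1 - \<alpha>\<^sub>1 - \<alpha>\<^sub>2 + (\<alpha>\<^sub>1 - \<alpha>\<^sub>2)\<^sup>2) / (1 - 4 * \<alpha>\<^sub>1 * \<alpha>\<^sub>2)" if "\<mu> < 1/4"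
    proof -
      have ne: "1 - 4 * \<mu> \<noteq> 0" using that by simp
      have "2 * t - lam * (t * 2) = 2 * t * ((1 - 4 * \<mu>) - \<nu> * (1 - \<nu>)) / (1 - 4 * \<mu>)"
        unfolding assms(5) using ne by (simp add: field_simps)
      also have "(1 - 4 * \<mu>) - \<nu> * (1 - \<nu>) = 1 - \<alpha>\<^sub>1 - \<alpha>\<^sub>2 + (\<alpha>\<^sub>1 - \<alpha>\<^sub>2)\<^sup>2"
        unfolding assms(3,4) by (simp add: algebra_simps power2_eq_square)
      finally show ?thesis by (simp add: assms(3) mult.assoc)
    qed
    then show ?thesis using gen[OF t order_refl] t by (auto simp: power2_eq_square)
  qed
  show ?thesis
  proof (intro conjI)
    show "\<forall>s\<ge>0. \<forall>t\<ge>0. integrable M (\<lambda>\<omega>. V s \<omega> * V t \<omega>)" using int by blast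
    show "\<mu> < 1/4 \<longrightarrow> (\<forall>s>0. \<forall>t>0. let r = min s t; q = max s t in
           expectation (\<lambda>\<omega>. V s \<omega> * V t \<omega>) = 2 * r * c_fun \<mu> (ln (q / r)) - lam * C_kernel \<mu> s t)"
      using cov by blast
    show "\<alpha>\<^sub>1 = \<alpha>\<^sub>2 \<and> \<alpha>\<^sub>1 \<in> {-1/2<..<1} \<longrightarrow> (\<forall>s t. 0 < s \<and> s \<le> t \<longrightarrow>
           expectation (\<lambda>\<omega>. V s \<omega> * V t \<omega>) = 2 * s / (1 + 2 * \<alpha>\<^sub>1) * (t / s) powr (- \<alpha>\<^sub>1))"
      using gen by blast
  qed (use var in blast)
qed

end
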